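(* Let $\beta\in(0,2)$ and let $C_1,C_2,C_3,c_*>0$ be constants. Then there are constants $c_1,c_2>0$, depending only on $\beta,C_1,C_2,C_3,c_*$, such that for all integers $n\ge2$, $p\ge1$ and all $S,R,T>0$ with $S\ge p$ and $$C_1p\le S\le C_2p,\qquad T(\log n)^{-1+\beta/2}\le C_3R^{\beta/2},\qquad T(\log n)^{c_*}\ge\max\{1,R^{\beta/2}\},$$ one has $$\inf_{\tilde\Sigma}\ \sup_{(\Sigma,\psi)\in\mathcal{G}_0(S,R)\times\mathcal{H}_\beta(T)}\mathbb{P}_{\Sigma,\psi}\big(\|\tilde\Sigma-\Sigma\|\ge c_1\underline r_{n,p}\big)>c_2,\qquad \underline r_{n,p}=S^{1/2}R^{1-\beta/2}\,T\,(\log n)^{-1+\beta/2},$$ where the infimum is taken over all estimators $\tilde\Sigma$, i.e. all measurable $\mathbb{R}^{p\times p}$-valued functions of $Y_1,\dots,Y_n$.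
   Context: Model: $Y_j=X_j+\varepsilon_j$, $j=1,\dots,n$, where $X_1,\dots,X_n$ are i.i.d. $\mathcal N(0,\Sigma)$ in $\mathbb{R}^p$ and $\varepsilon_1,\dots,\varepsilon_n$ are i.i.d. random vectors in $\mathbb{R}^p$, independent of $(X_j)$, with characteristic function $\psi(u)=\mathbb{E}[e^{i\langle u,\varepsilon_1\rangle}]$. Only $Y_1,\dots,Y_n$ are observed, and $\mathbb{P}_{\Sigma,\psi}$ denotes their joint distribution. $\|A\|=\sqrt{\operatorname{tr}(A^\top A)}$ is the Frobenius norm; for a matrix, $|A|_0$ is the number of non-zero entries and $|A|_\infty$ the largest absolute value of the entries; for $u\in\mathbb{R}^p$, $|u|_\beta^\beta=\sum_k|u_k|^\beta$. $$\mathcal{H}_\beta(T)=\big\{\psi\text{ characteristic function on }\mathbb{R}^p:\ \big|\log|\psi(u)|\big|\le T(1+|u|_\beta^\beta)\ \forall u\in\mathbb{R}^p\big\},$$ $$\mathcal{G}_0(S,R)=\big\{\Sigma\in\mathbb{R}^{p\times p}\text{ symmetric positive definite}:\ |\Sigma|_0\le S,\ |\Sigma|_\infty\le R\big\}.$$ *)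

theory Defs
  imports
    "HOL-Probability.Probability"
    "Jordan_Normal_Form.Gauss_Jordan_Elimination"
    "Jordan_Normal_Form.Determinant"
begin

(* The dimension p varies inside the statement, so R^p is not a type of its own.  A random vector
   takes values in the (extensional) functions {..<p} -> real, a sample in the functions
   {..<n} -> {..<p} -> real; the covariance parameters are matrices in carrier_mat p p. *)

definition vec_borel :: "nat \<Rightarrow> (nat \<Rightarrow> real) measure" where
  "vec_borel p = (\<Pi>\<^sub>M k\<in>{..<p}. borel)"

definition sample_borel :: "nat \<Rightarrow> nat \<Rightarrow> (nat \<Rightarrow> nat \<Rightarrow> real) measure" where
  "sample_borel n p = (\<Pi>\<^sub>M j\<in>{..<n}. vec_borel p)"

definition frobenius_norm :: "real mat \<Rightarrow> real" where
  "frobenius_norm A = sqrt (sum_list (diag_mat (transpose_mat A * A)))"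

definition num_nonzero :: "real mat \<Rightarrow> nat" where
  "num_nonzero A = card {(i, j). i < dim_row A \<and> j < dim_col A \<and> A $$ (i, j) \<noteq> 0}"

definition max_entry :: "real mat \<Rightarrow> real" where
  "max_entry A = Max ((\<lambda>x. \<bar>x\<bar>) ` elements_mat A)"

definition pos_def_mat :: "nat \<Rightarrow> real mat \<Rightarrow> bool" where
  "pos_def_mat p A \<longleftrightarrow>
     (\<forall>v \<in> carrier_vec p. v \<noteq> 0\<^sub>v p \<longrightarrow> scalar_prod v (A *\<^sub>v v) > 0)"

(* The law N(0, A) for symmetric positive definite A, through its Lebesgue density; such an A is
   invertible, so "the (mat_inverse A)" is its inverse. *)
definition mvn :: "nat \<Rightarrow> real mat \<Rightarrow> (nat \<Rightarrow> real) measure" where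
  "mvn p A = density (\<Pi>\<^sub>M k\<in>{..<p}. lborel)
     (\<lambda>x. ennreal (exp (- (scalar_prod (Matrix.vec p x)
                              (the (mat_inverse A) *\<^sub>v Matrix.vec p x)) / 2)
                    / sqrt ((2 * pi) ^ p * Determinant.det A)))"

(* Arguments u of characteristic functions range over all of nat => real, but only u 0, ..., u (p-1)
   matter. *)
definition char_vec :: "nat \<Rightarrow> (nat \<Rightarrow> real) measure \<Rightarrow> (nat \<Rightarrow> real) \<Rightarrow> complex" where
  "char_vec p \<nu> u = (CLINT x|\<nu>. iexp (\<Sum>k<p. u k * x k))"

definition law_with_char :: "nat \<Rightarrow> ((nat \<Rightarrow> real) \<Rightarrow> complex) \<Rightarrow> (nat \<Rightarrow> real) measure \<Rightarrow> bool" where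
  "law_with_char p \<psi> \<nu> \<longleftrightarrow>
     prob_space \<nu> \<and> sets \<nu> = sets (vec_borel p) \<and> \<psi> = char_vec p \<nu>"

(* The condition psi u \<noteq> 0 is needed because ln 0 = 0 in HOL, whereas |log 0| = infinity is
   meant. *)
definition char_class :: "nat \<Rightarrow> real \<Rightarrow> real \<Rightarrow> ((nat \<Rightarrow> real) \<Rightarrow> complex) set" where
  "char_class p \<beta> T = {\<psi>. (\<exists>\<nu>. law_with_char p \<psi> \<nu>) \<and>
     (\<forall>u. \<psi> u \<noteq> 0 \<and> \<bar>ln (cmod (\<psi> u))\<bar> \<le> T * (1 + (\<Sum>k<p. \<bar>u k\<bar> powr \<beta>)))}"

definition cov_class :: "nat \<Rightarrow> real \<Rightarrow> real \<Rightarrow> real mat set" where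
  "cov_class p S R = {A \<in> carrier_mat p p. transpose_mat A = A \<and> pos_def_mat p A \<and>
     real (num_nonzero A) \<le> S \<and> max_entry A \<le> R}"

(* Joint law of Y_j = X_j + eps_j, j < n, with X_j i.i.d. N(0, A) and, independently of them,
   eps_j i.i.d. with law \<nu>. *)
definition obs_law ::
  "nat \<Rightarrow> nat \<Rightarrow> real mat \<Rightarrow> (nat \<Rightarrow> real) measure \<Rightarrow> (nat \<Rightarrow> nat \<Rightarrow> real) measure" where
  "obs_law n p A \<nu> =
     distr ((\<Pi>\<^sub>M j\<in>{..<n}. mvn p A) \<Otimes>\<^sub>M (\<Pi>\<^sub>M j\<in>{..<n}. \<nu>)) (sample_borel n p)
       (\<lambda>(x, e). \<lambda>j\<in>{..<n}. \<lambda>k\<in>{..<p}. x j k + e j k)"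

(* The models (A, psi) of the parameter set G_0(S,R) x H_beta(T), each together with the error law
   of characteristic function psi.  That law is determined by psi, hence so is obs_law, which is
   the measure P_{A,psi}. *)
definition models ::
  "nat \<Rightarrow> real \<Rightarrow> real \<Rightarrow> real \<Rightarrow> real \<Rightarrow>
     (real mat \<times> ((nat \<Rightarrow> real) \<Rightarrow> complex) \<times> (nat \<Rightarrow> real) measure) set" where
  "models p \<beta> S R T = {(A, \<psi>, \<nu>).
     (A, \<psi>) \<in> cov_class p S R \<times> char_class p \<beta> T \<and> law_with_char p \<psi> \<nu>}"

definition estimators :: "nat \<Rightarrow> nat \<Rightarrow> ((nat \<Rightarrow> nat \<Rightarrow> real) \<Rightarrow> real mat) set" where
  "estimators n p = {est. (\<forall>y \<in> space (sample_borel n p). est y \<in> carrier_mat p p) \<and>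
     (\<forall>i<p. \<forall>j<p. (\<lambda>y. est y $$ (i, j)) \<in> borel_measurable (sample_borel n p))}"

definition rate :: "nat \<Rightarrow> real \<Rightarrow> real \<Rightarrow> real \<Rightarrow> real \<Rightarrow> real" where
  "rate n \<beta> S R T =
     S powr (1 / 2) * R powr (1 - \<beta> / 2) * T * ln (real n) powr (- 1 + \<beta> / 2)"

end

theory Submission
  imports Defs
begin

text \<open>
  Only diagonal covariance matrices are needed: coordinate \<open>k\<close> has variance \<open>R\<close> or \<open>R - \<delta>\<close>, where
  \<open>\<delta>\<close> is a small multiple of \<open>R powr (1 - \<beta> / 2) * T * (ln n) powr (- 1 + \<beta> / 2)\<close>, and the noise
  coordinates are independent compound Poisson variables that compensate the difference of the
  variances on the frequencies \<open>\<bar>u\<bar> \<le> U\<close>, with \<open>U\<close> of order \<open>sqrt (ln n / R)\<close>.  Their jump densities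
  are multiples of \<open>(1 - cos x)\<^sup>2 / x ^ 4\<close> and \<open>(1 - cos x) ^ 3 / x ^ 4\<close>.  Since the integral of
  \<open>(cos (d * x) - 1 + (d * x)\<^sup>2 / 2) / x ^ 4\<close> is a constant times \<open>d ^ 3\<close>, expanding the difference of
  the two exponents into cosines shows that it is exactly quadratic near the origin.
  The exponents are \<open>O(\<delta> * min (U\<^sup>2) (u\<^sup>2))\<close>, hence \<open>O(\<delta> * U powr (2 - \<beta>) * \<bar>u\<bar> powr \<beta>)\<close>, which gives the
  constraint on the noise class.  For \<open>\<bar>u\<bar> > U\<close> the Gaussian factor makes both characteristic
  functions smaller than a power of \<open>1 / n\<close>, so the two laws of one coordinate have total variation
  distance at most \<open>1 / (2 * n)\<close>, and Assouad's argument over the hypercube of the \<open>2 ^ p\<close> models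
  concludes.
\<close>

section \<open>A cubic homogeneous integral\<close>

text \<open>Noise under only one of the two hypotheses could not compensate the variances: a
  characteristic function that is Gaussian near the origin is Gaussian everywhere, because its
  moments determine the law, and \<beta> < 2 excludes such noise. So both hypotheses carry noise,
  neither exponent need be quadratic, and only their difference is prescribed on
  \<open>[-U, U]\<close>. The rate is the balance of two demands on \<open>U\<close>: it must be
  large for the remaining frequencies to be negligible after \<open>n\<close> observations, and
  small for \<open>\<delta> * U powr (2 - \<beta>)\<close> to stay below a multiple of
  \<open>T\<close>. A uniform bound on the difference of two densities is cheap by Fourier
  inversion, but gives no bound in L1 on the whole line; a Gaussian weight and a tail estimate
  bridge this gap. The risk is a real infimum of real suprema, and a supremum of reals is
  informative only if the set is bounded. Hence the normal law must be shown to have mass 1 for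
  every positive definite matrix, although the lower bound itself visits only diagonal ones.\<close>

lemma integrable_inverse_one_plus_square: "integrable lborel (\<lambda>x::real. inverse (1 + x\<^sup>2))"
  using integrable_inverse_1_plus_square by (simp add: set_integrable_def)

lemma one_minus_cos_le: "1 - cos x \<le> x\<^sup>2 / 2" for x :: real
proof -
  have "\<bar>sin (x / 2)\<bar> \<le> \<bar>x / 2\<bar>" by (rule abs_sin_x_le_abs_x)
  then have "(sin (x / 2))\<^sup>2 \<le> (x / 2)\<^sup>2" by (rule abs_le_square_iff[THEN iffD1])
  then show ?thesis using cos_double_sin[of "x / 2"] by (simp add: power2_eq_square)
qed

text \<open>Subtracting the quadratic Taylor polynomial keeps the quotient bounded near 0 and of
  order \<open>1 / x\<^sup>2\<close> at infinity, hence integrable. At \<open>x = 0\<close> division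
  by zero gives 0, which is harmless on a null set.\<close>

definition cos_remainder :: "real \<Rightarrow> real \<Rightarrow> real" where
  "cos_remainder d x = (cos (d * x) - 1 + (d * x)\<^sup>2 / 2) / x ^ 4"

lemma cos_remainder_measurable [measurable]: "cos_remainder d \<in> borel_measurable borel"
  unfolding cos_remainder_def[abs_def] by measurable

lemma cos_remainder_nonneg: "0 \<le> cos_remainder d x"
  using one_minus_cos_le[of "d * x"] unfolding cos_remainder_def by (intro divide_nonneg_nonneg) auto

lemma cos_le_taylor: "cos x - 1 + x\<^sup>2 / 2 \<le> x ^ 4 / 24" for x :: real
proof -
  obtain t where t: "cos x = (\<Sum>m<4. cos_coeff m * x ^ m) + cos (t + 1 / 2 * real 4 * pi) / fact 4 * x ^ 4"
    using Maclaurin_cos_expansion[of x 4] by blast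
  have "cos (t + 1 / 2 * real 4 * pi) / fact 4 * x ^ 4 \<le> 1 / fact 4 * x ^ 4"
    by (intro mult_right_mono divide_right_mono) auto
  moreover have "(\<Sum>m<4. cos_coeff m * x ^ m) = 1 - x\<^sup>2 / 2"
  proof -
    have "{..<4} = {0, 1, 2, 3 :: nat}" by auto
    then show ?thesis by (simp add: cos_coeff_def)
  qed
  ultimately show ?thesis using t by (simp add: fact_numeral)
qed

lemma integrable_cos_remainder_1: "integrable lborel (cos_remainder 1)"
proof (rule Bochner_Integration.integrable_bound)
  show "integrable lborel (\<lambda>x::real. inverse (1 + x\<^sup>2))"
    by (rule integrable_inverse_one_plus_square)
  have "cos_remainder 1 x \<le> inverse (1 + x\<^sup>2)" for x
  proof (cases "x = 0")
    case False
    define r where "r = cos x - 1 + x\<^sup>2 / 2"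
    have r: "r \<le> x ^ 4 / 24" "r \<le> x\<^sup>2 / 2" "0 \<le> r"
      using cos_le_taylor[of x] one_minus_cos_le[of x] by (auto simp: r_def)
    have "r * (1 + x\<^sup>2) = r + r * x\<^sup>2" by (simp add: algebra_simps)
    also have "\<dots> \<le> x ^ 4 / 24 + x\<^sup>2 / 2 * x\<^sup>2"
      using r by (intro add_mono mult_right_mono) auto
    also have "x\<^sup>2 / 2 * x\<^sup>2 = x ^ 4 / 2" by (simp add: power2_eq_square power4_eq_xxxx)
    also have "x ^ 4 / 24 + x ^ 4 / 2 \<le> x ^ 4" using zero_le_even_power'[of x 2] by simp
    finally have "r * (1 + x\<^sup>2) \<le> x ^ 4" .
    moreover have "0 < 1 + x\<^sup>2" "0 < x ^ 4" using False by (auto intro: add_pos_nonneg)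
    ultimately have "r / x ^ 4 \<le> inverse (1 + x\<^sup>2)"
      by (simp add: field_simps)
    then show ?thesis by (simp add: cos_remainder_def r_def)
  qed (simp add: cos_remainder_def)
  then show "AE x in lborel. norm (cos_remainder 1 x) \<le> norm (inverse (1 + x\<^sup>2))"
    using cos_remainder_nonneg by simp
qed simp

definition cos_kappa :: real where "cos_kappa = (\<integral>x. cos_remainder 1 x \<partial>lborel)"

lemma cos_remainder_scale: "cos_remainder d x = d ^ 4 * cos_remainder 1 (d * x)"
proof (cases "d = 0")
  case False
  then show ?thesis
    unfolding cos_remainder_def power_mult_distrib mult_1 by simp
qed (simp add: cos_remainder_def)

text \<open>The substitution \<open>d * x\<close> costs a factor \<open>1 / d\<close>, which turns
  \<open>d ^ 4\<close> into \<open>d ^ 3\<close>. For negative \<open>d\<close> the value would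
  involve \<open>\<bar>d\<bar>\<close>; for \<open>0 \<le> d\<close> it is a polynomial, which is
  what \<open>jump_exponent_diff\<close> exploits.\<close>

lemma has_bochner_integral_cos_remainder:
  assumes "0 \<le> d"
  shows "has_bochner_integral lborel (cos_remainder d) (d ^ 3 * cos_kappa)"
proof (cases "d = 0")
  case True
  then show ?thesis by (simp add: cos_remainder_def[abs_def] has_bochner_integral_zero)
next
  case False
  have "has_bochner_integral lborel (cos_remainder 1) cos_kappa"
    using integrable_cos_remainder_1 by (simp add: cos_kappa_def has_bochner_integral_integrable)
  from lborel_has_bochner_integral_real_affine_iff[where c=d and t=0 and f="cos_remainder 1" and x=cos_kappa, OF False, THEN iffD1, OF this]
  have "has_bochner_integral lborel (\<lambda>x. d ^ 4 * cos_remainder 1 (d * x)) (d ^ 4 * (cos_kappa / \<bar>d\<bar>))"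
    by (intro has_bochner_integral_mult_right) (simp_all add: divide_inverse mult.commute)
  moreover have "d ^ 4 * (cos_kappa / \<bar>d\<bar>) = d ^ 3 * cos_kappa"
    using assms False by (simp add: power4_eq_xxxx power3_eq_cube)
  ultimately show ?thesis
    by (simp add: cos_remainder_scale[symmetric, abs_def])
qed

lemma cos_kappa_pos: "0 < cos_kappa"
proof -
  have "0 \<le> cos_kappa" unfolding cos_kappa_def by (rule Bochner_Integration.integral_nonneg) (rule cos_remainder_nonneg)
  moreover have "cos_kappa \<noteq> 0"
  proof
    assume "cos_kappa = 0"
    then have "AE x in lborel. cos_remainder 1 x = 0"
      unfolding cos_kappa_def using integral_nonneg_eq_0_iff_AE[OF integrable_cos_remainder_1]
      by (simp add: cos_remainder_nonneg)
    \<comment> \<open>Non-vanishing on one interval of positive length is enough; beyond 4 the crude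
      bound \<open>cos x \<ge> -1\<close> gives it.\<close>
    moreover have "cos_remainder 1 x \<noteq> 0" if "4 < x" for x
    proof -
      have "4 * 4 < x * x" using that by (intro mult_strict_mono) auto
      then have "0 < cos x - 1 + x\<^sup>2 / 2" using cos_ge_minus_one[of x] unfolding power2_eq_square by linarith
      then show ?thesis using that by (simp add: cos_remainder_def)
    qed
    ultimately have "AE x in lborel. x \<notin> {4<..<5::real}"
      by (auto elim!: eventually_mono)
    then have "emeasure lborel {4<..<5::real} = 0"
      by (subst (asm) AE_iff_measurable[OF _ refl]) (auto simp: greaterThanLessThan_def greaterThan_def lessThan_def Int_def)
    then show False by simp
  qed
  ultimately show ?thesis by simp
qed

section \<open>Two compound Poisson exponents\<close>

text \<open>Both numerators are bounded and vanish at 0 to order at least 4, so mass and second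
  moment are finite. The factors 20 and 12 give them the same mean value 30 over a period: a
  surviving frequency 0 would add a multiple of \<open>\<bar>v\<bar> ^ 3\<close> to the difference
  of the exponents, which would then not be quadratic at the origin.\<close>

definition jump_density :: "bool \<Rightarrow> real \<Rightarrow> real" where
  "jump_density b x = (if b then 20 * (1 - cos x)\<^sup>2 / x ^ 4 else 12 * (1 - cos x) ^ 3 / x ^ 4)"

lemma jump_density_measurable [measurable]: "jump_density b \<in> borel_measurable borel"
  unfolding jump_density_def[abs_def] by (cases b) simp_all

lemma jump_density_nonneg: "0 \<le> jump_density b x"
  by (auto simp: jump_density_def intro!: divide_nonneg_nonneg)

lemma jump_density_even: "jump_density b (- x) = jump_density b x"
  by (simp add: jump_density_def)

lemma jump_density_le: "jump_density b x \<le> 24 * (1 - cos x)\<^sup>2 / x ^ 4"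
proof -
  have "12 * (1 - cos x) ^ 3 = 12 * (1 - cos x) * (1 - cos x)\<^sup>2"
    by (simp add: power3_eq_cube power2_eq_square)
  also have "\<dots> \<le> 24 * (1 - cos x)\<^sup>2"
    using cos_ge_minus_one[of x] by (intro mult_right_mono) (auto simp del: cos_ge_minus_one)
  finally show ?thesis
    unfolding jump_density_def by (auto intro!: divide_right_mono mult_right_mono)
qed

lemma one_minus_cos_square_le: "(1 - cos x)\<^sup>2 \<le> x\<^sup>2" for x :: real
proof -
  have "(1 - cos x) * (1 - cos x) \<le> 2 * (x\<^sup>2 / 2)"
    using one_minus_cos_le[of x] cos_ge_minus_one[of x]
    by (intro mult_mono) (auto simp del: cos_ge_minus_one)
  then show ?thesis by (simp add: power2_eq_square)
qed

lemma jump_fraction_le: "0 < b \<Longrightarrow> 0 < c \<Longrightarrow> a * c \<le> 5 * b \<Longrightarrow> 24 * a / b \<le> 120 * inverse c" for a b c :: real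
  by (simp add: field_simps)

lemma jump_density_bound: "jump_density b x \<le> 120 * inverse (1 + x\<^sup>2)"
proof (cases "x = 0")
  case False
  have "(1 - cos x) * (1 - cos x) \<le> (x\<^sup>2 / 2) * (x\<^sup>2 / 2)"
    using one_minus_cos_le[of x] by (intro mult_mono) auto
  then have "(1 - cos x)\<^sup>2 \<le> x ^ 4 / 4" by (simp add: power2_eq_square power4_eq_xxxx)
  moreover have "(1 - cos x)\<^sup>2 * x\<^sup>2 \<le> x\<^sup>2 * x\<^sup>2"
    by (intro mult_right_mono one_minus_cos_square_le) simp
  moreover have "x\<^sup>2 * x\<^sup>2 = x ^ 4" by (simp add: power2_eq_square power4_eq_xxxx)
  moreover have "0 \<le> x ^ 4" by simp
  ultimately have "(1 - cos x)\<^sup>2 * (1 + x\<^sup>2) \<le> 5 * x ^ 4"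
    unfolding ring_distribs using \<open>0 \<le> x ^ 4\<close> by linarith
  moreover have "0 < 1 + x\<^sup>2" "0 < x ^ 4" using False by (auto intro: add_pos_nonneg)
  ultimately have "24 * (1 - cos x)\<^sup>2 / x ^ 4 \<le> 120 * inverse (1 + x\<^sup>2)"
    by (intro jump_fraction_le)
  with jump_density_le[of b x] show ?thesis by linarith
qed (auto simp: jump_density_def)

lemma jump_density_moment_bound: "x\<^sup>2 * jump_density b x \<le> 120 * inverse (1 + x\<^sup>2)"
proof (cases "x = 0")
  case False
  have "(1 - cos x) * (1 - cos x) \<le> 2 * 2" 
    using cos_ge_minus_one[of x] by (intro mult_mono) (auto simp del: cos_ge_minus_one)
  then have "(1 - cos x)\<^sup>2 * x\<^sup>2 \<le> 4 * x\<^sup>2" 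
    by (intro mult_right_mono) (auto simp: power2_eq_square)
  with one_minus_cos_square_le[of x] have *: "(1 - cos x)\<^sup>2 * (1 + x\<^sup>2) \<le> 5 * x\<^sup>2"
    by (simp add: algebra_simps)
  have "x\<^sup>2 * jump_density b x \<le> x\<^sup>2 * (24 * (1 - cos x)\<^sup>2 / x ^ 4)"
    by (intro mult_left_mono jump_density_le) simp
  also have "\<dots> = 24 * (1 - cos x)\<^sup>2 / x\<^sup>2"
    using False by (simp add: field_simps power2_eq_square power4_eq_xxxx)
  also have "\<dots> \<le> 120 * inverse (1 + x\<^sup>2)"
  proof -
    have "0 < 1 + x\<^sup>2" "0 < x\<^sup>2" using False by (auto intro: add_pos_nonneg)
    with * show ?thesis by (intro jump_fraction_le)
  qed
  finally show ?thesis .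
qed simp

lemma integrable_jump_density: "integrable lborel (jump_density b)"
  by (rule Bochner_Integration.integrable_bound[OF integrable_mult_right[OF integrable_inverse_one_plus_square, of 120]])
     (use jump_density_bound[of b] jump_density_nonneg[of b] in auto)

lemma integrable_jump_density_moment: "integrable lborel (\<lambda>x. x\<^sup>2 * jump_density b x)"
  by (rule Bochner_Integration.integrable_bound[OF integrable_mult_right[OF integrable_inverse_one_plus_square, of 120]])
     (use jump_density_moment_bound[of _ b] jump_density_nonneg[of b] in auto)

text \<open>The Levy exponent of the compound Poisson law with jump intensity
  \<open>jump_density b\<close>: the characteristic function is
  \<open>exp (- jump_exponent b v)\<close>, real because the density is even.\<close>

definition jump_exponent :: "bool \<Rightarrow> real \<Rightarrow> real" where
  "jump_exponent b v = (\<integral>x. (1 - cos (v * x)) * jump_density b x \<partial>lborel)"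

lemma integrable_jump_exponent: "integrable lborel (\<lambda>x. (1 - cos (v * x)) * jump_density b x)"
proof (rule Bochner_Integration.integrable_bound[OF integrable_mult_right[OF integrable_jump_density[of b], of 2]])
  show "AE x in lborel. norm ((1 - cos (v * x)) * jump_density b x) \<le> norm (2 * jump_density b x)"
  proof (rule AE_I2)
    fix x
    have "\<bar>1 - cos (v * x)\<bar> \<le> 2" using cos_ge_minus_one[of "v * x"] cos_le_one[of "v * x"] by linarith
    then show "norm ((1 - cos (v * x)) * jump_density b x) \<le> norm (2 * jump_density b x)"
      using jump_density_nonneg[of b x] by (simp add: abs_mult mult_right_mono)
  qed
qed simp

lemma jump_exponent_nonneg: "0 \<le> jump_exponent b v"
  unfolding jump_exponent_def
  by (intro Bochner_Integration.integral_nonneg mult_nonneg_nonneg jump_density_nonneg) simp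

text \<open>One constant serves both densities and both the bounded and the quadratic estimate. The
  summand 1 makes it positive without evaluating an integral.\<close>

definition jump_const :: real where
  "jump_const = 1 + (\<Sum>b\<in>UNIV. 2 * (\<integral>x. jump_density b x \<partial>lborel) + (\<integral>x. x\<^sup>2 * jump_density b x \<partial>lborel))"

lemma jump_const_bounds:
  shows jump_const_mass: "2 * (\<integral>x. jump_density b x \<partial>lborel) \<le> jump_const"
    and jump_const_moment: "(\<integral>x. x\<^sup>2 * jump_density b x \<partial>lborel) \<le> jump_const"
    and jump_const_pos: "0 < jump_const"
proof -
  have nn: "0 \<le> (\<integral>x. jump_density b x \<partial>lborel)" "0 \<le> (\<integral>x. x\<^sup>2 * jump_density b x \<partial>lborel)" for b
    by (auto intro!: Bochner_Integration.integral_nonneg simp: jump_density_nonneg)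
  show "2 * (\<integral>x. jump_density b x \<partial>lborel) \<le> jump_const"
    "(\<integral>x. x\<^sup>2 * jump_density b x \<partial>lborel) \<le> jump_const" "0 < jump_const"
    using nn[of True] nn[of False] by (cases b; simp add: jump_const_def UNIV_bool)+
qed

lemma jump_exponent_le_mass: "jump_exponent b v \<le> 2 * (\<integral>x. jump_density b x \<partial>lborel)"
proof -
  have "jump_exponent b v \<le> (\<integral>x. 2 * jump_density b x \<partial>lborel)"
    unfolding jump_exponent_def
  proof (rule integral_mono[OF integrable_jump_exponent])
    fix x
    have "1 - cos (v * x) \<le> 2" using cos_ge_minus_one[of "v * x"] by linarith
    then show "(1 - cos (v * x)) * jump_density b x \<le> 2 * jump_density b x"
      using jump_density_nonneg by (rule mult_right_mono)
  qed (use integrable_jump_density in simp)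
  then show ?thesis by simp
qed

lemma jump_exponent_le_const: "jump_exponent b v \<le> jump_const"
  using jump_exponent_le_mass jump_const_mass by (rule order_trans)

lemma jump_exponent_le_square: "jump_exponent b v \<le> jump_const * v\<^sup>2"
proof -
  have "jump_exponent b v \<le> (\<integral>x. v\<^sup>2 * (x\<^sup>2 * jump_density b x) \<partial>lborel)"
    unfolding jump_exponent_def
  proof (rule integral_mono[OF integrable_jump_exponent])
    fix x
    have "1 - cos (v * x) \<le> v\<^sup>2 * x\<^sup>2" using one_minus_cos_le[of "v * x"] zero_le_power2[of "v * x"]
      unfolding power_mult_distrib by linarith
    then have "(1 - cos (v * x)) * jump_density b x \<le> v\<^sup>2 * x\<^sup>2 * jump_density b x"
      using jump_density_nonneg by (rule mult_right_mono)
    then show "(1 - cos (v * x)) * jump_density b x \<le> v\<^sup>2 * (x\<^sup>2 * jump_density b x)" by (simp add: mult.assoc)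
  qed (use integrable_jump_density_moment in simp)
  also have "\<dots> \<le> v\<^sup>2 * jump_const" using jump_const_moment[of b] by (simp add: mult_left_mono)
  finally show ?thesis by (simp add: mult.commute)
qed

text \<open>Interpolation between the bounded and the quadratic estimate: \<open>v\<^sup>2\<close>
  lies below the power for \<open>\<bar>v\<bar> \<le> 1\<close>, and 1 lies below it
  otherwise.\<close>

lemma jump_exponent_le_powr:
  assumes "0 < \<beta>" "\<beta> < 2"
  shows "jump_exponent b v \<le> jump_const * \<bar>v\<bar> powr \<beta>"
proof (cases "\<bar>v\<bar> \<le> 1")
  case True
  have "v\<^sup>2 \<le> \<bar>v\<bar> powr \<beta>"
  proof (cases "v = 0")
    case False
    then have "\<bar>v\<bar> powr 2 \<le> \<bar>v\<bar> powr \<beta>" using True assms by (intro powr_mono') auto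
    then show ?thesis using False by (simp add: powr_numeral)
  qed simp
  then show ?thesis using jump_exponent_le_square[of b v] jump_const_pos
    by (smt (verit) mult_left_mono)
next
  case False
  then have "1 \<le> \<bar>v\<bar> powr \<beta>" using assms by (intro ge_one_powr_ge_zero) auto
  then have "jump_const * 1 \<le> jump_const * \<bar>v\<bar> powr \<beta>" using jump_const_pos by (intro mult_left_mono) auto
  then show ?thesis using jump_exponent_le_const[of b v] by simp
qed

text \<open>The weights 5, -8, 3 kill the constant and the quadratic part of the cosine expansion at
  frequencies 1, 2, 3, so that the difference of the jump densities is bounded at the origin.\<close>

lemma jump_density_diff:
  "(1 - cos (v * x)) * (jump_density True x - jump_density False x) =
     5 * cos_remainder 1 x - 8 * cos_remainder 2 x + 3 * cos_remainder 3 x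
     - (5 * (cos_remainder (1 + v) x + cos_remainder (1 - v) x)
        - 8 * (cos_remainder (2 + v) x + cos_remainder (2 - v) x)
        + 3 * (cos_remainder (3 + v) x + cos_remainder (3 - v) x)) / 2"
proof -
  define c y where "c = cos x" and "y = cos (v * x)"
  have s: "cos ((k + v) * x) + cos ((k - v) * x) = 2 * cos (k * x) * y" for k
    by (simp add: y_def algebra_simps cos_add cos_diff)
  have c: "cos (2 * x) = 2 * c\<^sup>2 - 1" "cos (3 * x) = 4 * c ^ 3 - 3 * c"
    by (simp_all add: c_def cos_double_cos cos_treble_cos)
  let ?q = "\<lambda>d. cos (d * x) - 1 + (d * x)\<^sup>2 / 2"
  have q: "?q (k + v) + ?q (k - v) = 2 * cos (k * x) * y - 2 + (k\<^sup>2 + v\<^sup>2) * x\<^sup>2" for k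
    unfolding s[symmetric] by (simp add: power2_eq_square field_simps)
  have "20 * (1 - cos x)\<^sup>2 - 12 * (1 - cos x) ^ 3 = 5 * c - 8 * (2 * c\<^sup>2 - 1) + 3 * (4 * c ^ 3 - 3 * c)"
    by (simp add: c_def[symmetric] power2_eq_square power3_eq_cube algebra_simps)
  then have "(1 - y) * (20 * (1 - cos x)\<^sup>2 - 12 * (1 - cos x) ^ 3) =
     5 * ?q 1 - 8 * ?q 2 + 3 * ?q 3
     - (5 * (?q (1 + v) + ?q (1 - v)) - 8 * (?q (2 + v) + ?q (2 - v)) + 3 * (?q (3 + v) + ?q (3 - v))) / 2"
    unfolding q c using c_def by (simp add: power2_eq_square power3_eq_cube algebra_simps add_divide_distrib diff_divide_distrib)
  then have "(1 - y) * (20 * (1 - cos x)\<^sup>2 - 12 * (1 - cos x) ^ 3) / x ^ 4 =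
     (5 * ?q 1 - 8 * ?q 2 + 3 * ?q 3
     - (5 * (?q (1 + v) + ?q (1 - v)) - 8 * (?q (2 + v) + ?q (2 - v)) + 3 * (?q (3 + v) + ?q (3 - v))) / 2) / x ^ 4"
    by (simp only:)
  then show ?thesis
    unfolding y_def jump_density_def cos_remainder_def
    by (simp only: if_True if_False times_divide_eq_right add_divide_distrib[symmetric] diff_divide_distrib[symmetric])
       (simp add: diff_divide_distrib add_divide_distrib)
qed

text \<open>For \<open>\<bar>v\<bar> \<le> 1\<close> all frequencies \<open>k + v\<close> and
  \<open>k - v\<close> with \<open>k = 1, 2, 3\<close> are nonnegative, so cubes appear without
  absolute values: half of \<open>(k + v) ^ 3 + (k - v) ^ 3\<close> is
  \<open>k ^ 3 + 3 * k * v\<^sup>2\<close>. The cubes \<open>k ^ 3\<close> cancel, and 6 is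
  \<open>-3 * (5 * 1 - 8 * 2 + 3 * 3)\<close>.\<close>

lemma jump_exponent_diff:
  assumes "\<bar>v\<bar> \<le> 1"
  shows "jump_exponent True v - jump_exponent False v = 6 * cos_kappa * v\<^sup>2"
proof -
  have "jump_exponent True v - jump_exponent False v =
      (\<integral>x. (1 - cos (v * x)) * (jump_density True x - jump_density False x) \<partial>lborel)"
    unfolding jump_exponent_def using integrable_jump_exponent
    by (simp add: right_diff_distrib Bochner_Integration.integral_diff)
  also have "has_bochner_integral lborel (\<lambda>x. (1 - cos (v * x)) * (jump_density True x - jump_density False x))
     (5 * (1 ^ 3 * cos_kappa) - 8 * (2 ^ 3 * cos_kappa) + 3 * (3 ^ 3 * cos_kappa)
     - (5 * ((1 + v) ^ 3 * cos_kappa + (1 - v) ^ 3 * cos_kappa)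
        - 8 * ((2 + v) ^ 3 * cos_kappa + (2 - v) ^ 3 * cos_kappa)
        + 3 * ((3 + v) ^ 3 * cos_kappa + (3 - v) ^ 3 * cos_kappa)) / 2)"
    unfolding jump_density_diff using assms
    by (intro has_bochner_integral_diff has_bochner_integral_add has_bochner_integral_mult_right
      has_bochner_integral_divide_zero has_bochner_integral_cos_remainder) auto
  then have "(\<integral>x. (1 - cos (v * x)) * (jump_density True x - jump_density False x) \<partial>lborel) =
     (5 * (1 ^ 3 * cos_kappa) - 8 * (2 ^ 3 * cos_kappa) + 3 * (3 ^ 3 * cos_kappa)
     - (5 * ((1 + v) ^ 3 * cos_kappa + (1 - v) ^ 3 * cos_kappa)
        - 8 * ((2 + v) ^ 3 * cos_kappa + (2 - v) ^ 3 * cos_kappa)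
        + 3 * ((3 + v) ^ 3 * cos_kappa + (3 - v) ^ 3 * cos_kappa)) / 2)"
    by (rule has_bochner_integral_integral_eq)
  also have "\<dots> = 6 * cos_kappa * v\<^sup>2"
    by (simp add: power2_eq_square power3_eq_cube field_simps)
  finally show ?thesis .
qed

section \<open>Compound Poisson laws with real characteristic function\<close>

lemma (in real_distribution) Re_Im_char:
  shows Re_char: "Re (char M t) = (\<integral>x. cos (t * x) \<partial>M)"
    and Im_char: "Im (char M t) = (\<integral>x. sin (t * x) \<partial>M)"
proof -
  have "integrable M (\<lambda>x. iexp (t * x))"
    by (intro integrable_const_bound[of _ 1]) auto
  from integral_Re[OF this] integral_Im[OF this]
  show "Re (char M t) = (\<integral>x. cos (t * x) \<partial>M)" "Im (char M t) = (\<integral>x. sin (t * x) \<partial>M)"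
    by (simp_all add: char_def Re_exp Im_exp del: integral_Re integral_Im)
qed

text \<open>All one-dimensional laws of the construction are symmetric, so each claim on their
  characteristic functions splits into a cosine integral and a vanishing sine integral.\<close>

lemma (in real_distribution) char_eq_of_real_iff:
  "char M t = of_real g \<longleftrightarrow> (\<integral>x. cos (t * x) \<partial>M) = g \<and> (\<integral>x. sin (t * x) \<partial>M) = 0"
  by (simp add: complex_eq_iff Re_char Im_char)

lemma real_distribution_convolution:
  assumes "real_distribution M" "real_distribution N"
  shows "real_distribution (M \<star> N)"
proof -
  interpret M: real_distribution M by fact
  interpret N: real_distribution N by fact
  interpret pair_prob_space M N ..
  show ?thesis
    unfolding real_distribution_def real_distribution_axioms_def convolution_def
    by (auto intro!: prob_space_distr)
qed

lemma char_convolution: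
  assumes "real_distribution M" "real_distribution N"
  shows "char (M \<star> N) t = char M t * char N t"
proof -
  interpret M: real_distribution M by fact
  interpret N: real_distribution N by fact
  interpret pair_prob_space M N ..
  have int: "integrable (M \<Otimes>\<^sub>M N) (\<lambda>(x, y). iexp (t * x) * iexp (t * y))"
    by (intro integrable_const_bound[of _ 1]) (auto simp: norm_mult)
  have "char (M \<star> N) t = (CLINT z|M \<Otimes>\<^sub>M N. case z of (x, y) \<Rightarrow> iexp (t * x) * iexp (t * y))"
    by (simp add: char_def convolution_def integral_distr split_beta distrib_left exp_add)
  also have "\<dots> = (CLINT x|M. CLINT y|N. iexp (t * x) * iexp (t * y))"
    using integral_fst[OF int] by simp
  also have "\<dots> = char M t * char N t"
    by (simp add: char_def)
  finally show ?thesis .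
qed

lemma real_distribution_return: "real_distribution (return borel x)"
  by (simp add: real_distribution_def real_distribution_axioms_def prob_space_return)

lemma char_return_0: "char (return borel 0) t = 1"
  by (simp add: char_def integral_return)

section \<open>Poisson mixtures of convolution powers\<close>

primrec convolution_power :: "real measure \<Rightarrow> nat \<Rightarrow> real measure" where
  "convolution_power M 0 = return borel 0"
| "convolution_power M (Suc n) = (M \<star> convolution_power M n)"

lemma real_distribution_convolution_power:
  "real_distribution M \<Longrightarrow> real_distribution (convolution_power M n)"
  by (induction n) (auto intro: real_distribution_return real_distribution_convolution)

lemma char_convolution_power:
  "real_distribution M \<Longrightarrow> char (convolution_power M n) t = char M t ^ n"
  by (induction n) (auto simp: char_return_0 char_convolution real_distribution_convolution_power)

lemma poisson_generating_function:
  assumes "0 < l" "\<bar>z\<bar> \<le> 1"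
  shows "(\<integral>n. z ^ n \<partial>poisson_pmf l) = exp (l * (z - 1))"
proof -
  have "integrable (poisson_pmf l) (\<lambda>n. z ^ n)"
    using assms by (intro measure_pmf.integrable_const_bound[of _ 1]) (auto simp: power_abs power_le_one)
  then have int: "integrable (count_space UNIV) (\<lambda>n. pmf (poisson_pmf l) n * z ^ n)"
    unfolding measure_pmf_eq_density by (subst (asm) integrable_density) auto
  have "(\<integral>n. z ^ n \<partial>poisson_pmf l) = (\<integral>n. pmf (poisson_pmf l) n * z ^ n \<partial>count_space UNIV)"
    unfolding measure_pmf_eq_density by (subst integral_density) auto
  moreover have "(\<lambda>n. pmf (poisson_pmf l) n * z ^ n) sums (\<integral>n. pmf (poisson_pmf l) n * z ^ n \<partial>count_space UNIV)"
    using int by (rule sums_integral_count_space_nat)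
  moreover have "(\<lambda>n. exp (- l) * ((l * z) ^ n /\<^sub>R fact n)) sums (exp (- l) * exp (l * z))"
    by (intro sums_mult exp_converges)
  moreover have "(\<lambda>n. exp (- l) * ((l * z) ^ n /\<^sub>R fact n)) = (\<lambda>n. pmf (poisson_pmf l) n * z ^ n)"
    using assms by (auto simp: power_mult_distrib field_simps)
  ultimately have "(\<integral>n. z ^ n \<partial>poisson_pmf l) = exp (- l) * exp (l * z)"
    using sums_unique2 by metis
  then show ?thesis by (simp add: exp_add[symmetric] algebra_simps)
qed

text \<open>Given \<open>n\<close> jumps the transform is \<open>g u ^ n\<close>; averaging over a
  Poisson number of jumps evaluates the generating function at \<open>g u\<close>, which lies in
  \<open>[-1, 1]\<close>. For \<open>l = 0\<close>, where the generating function above does not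
  apply, the Dirac mass at 0 serves.\<close>

lemma compound_poisson_exists:
  assumes "real_distribution M" "0 \<le> l" "\<And>u. char M u = of_real (g u)"
  shows "\<exists>N. real_distribution N \<and> (\<forall>u. char N u = of_real (exp (l * (g u - 1))))"
proof (cases "l = 0")
  case True
  then show ?thesis using real_distribution_return[of 0] char_return_0 by (intro exI[of _ "return borel 0"]) auto
next
  case False
  with assms have l: "0 < l" by simp
  let ?c = "convolution_power M"
  define N where "N = measure_pmf (poisson_pmf l) \<bind> ?c"
  have c: "real_distribution (?c n)" for n
    by (rule real_distribution_convolution_power) fact
  then have meas [measurable]: "?c \<in> measurable (measure_pmf (poisson_pmf l)) (subprob_algebra borel)"
    by (simp add: space_subprob_algebra real_distribution_def real_distribution_axioms_def
        prob_space_imp_subprob_space)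
  have "prob_space N"
    unfolding N_def using c
    by (intro measure_pmf.prob_space_bind[OF _ meas]) (auto simp: real_distribution_def)
  moreover have "sets N = sets borel"
    unfolding N_def by (intro sets_bind[where N=borel]) (auto simp: sets_kernel[OF meas])
  ultimately have N: "real_distribution N"
    by (simp add: real_distribution_def real_distribution_axioms_def)
  have bind: "(\<integral>x. f x \<partial>N) = (\<integral>n. (\<integral>x. f x \<partial>?c n) \<partial>poisson_pmf l)"
    if [measurable]: "f \<in> borel_measurable borel" and "\<And>x. \<bar>f x\<bar> \<le> 1" for f :: "real \<Rightarrow> real"
    unfolding N_def
  proof (rule integral_bind)
    show "f \<in> borel_measurable borel" "?c \<in> measurable (measure_pmf (poisson_pmf l)) (subprob_algebra borel)"
      by fact+
    show "\<And>x. x \<in> space borel \<Longrightarrow> \<bar>f x\<bar> \<le> 1" by (simp add: that)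
    show "finite_measure (measure_pmf (poisson_pmf l))" by (rule measure_pmf.finite_measure_axioms)
    show "AE n in poisson_pmf l. emeasure (?c n) (space (?c n)) \<le> ennreal 1"
      using c by (simp add: prob_space.emeasure_space_1 real_distribution_def)
  qed
  have g: "\<bar>g u\<bar> \<le> 1" for u
    using real_distribution.cmod_char_le_1[OF assms(1), of u] assms(3)[of u] by simp
  have cn: "(\<integral>x. cos (u * x) \<partial>?c n) = g u ^ n \<and> (\<integral>x. sin (u * x) \<partial>?c n) = 0" for u n
    using real_distribution.char_eq_of_real_iff[OF c, of n u "g u ^ n"] char_convolution_power[OF assms(1), of n u]
    by (simp add: assms(3))
  have "char N u = of_real (exp (l * (g u - 1)))" for u
    unfolding real_distribution.char_eq_of_real_iff[OF N]
    using bind[of "\<lambda>x. cos (u * x)"] bind[of "\<lambda>x. sin (u * x)"] cn poisson_generating_function[OF l g, of u]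
    by simp
  with N show ?thesis by blast
qed

lemma integral_sin_even_eq_0:
  fixes f :: "real \<Rightarrow> real"
  assumes "\<And>x. f (- x) = f x"
  shows "(\<integral>x. f x * sin (t * x) \<partial>lborel) = 0"
proof -
  have "(\<integral>x. f x * sin (t * x) \<partial>lborel) = (\<integral>x. f (- x) * sin (t * - x) \<partial>lborel)"
    by (subst lborel_integral_real_affine[where c="-1" and t=0]) auto
  also have "\<dots> = - (\<integral>x. f x * sin (t * x) \<partial>lborel)"
    by (simp add: assms)
  finally show ?thesis by simp
qed

text \<open>The jump density is normalised by its mass \<open>m\<close>, the jumps are divided by
  \<open>U\<close>, and the Poisson rate is \<open>s * m\<close>, so that \<open>m\<close> cancels
  in the exponent.\<close>

lemma jump_law_exists:
  assumes "0 \<le> s" "0 < U"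
  shows "\<exists>N. real_distribution N \<and> (\<forall>u. char N u = of_real (exp (- s * jump_exponent b (u / U))))"
proof -
  define m where "m = (\<integral>x. jump_density b x \<partial>lborel)"
  have m0: "0 \<le> m" unfolding m_def by (intro Bochner_Integration.integral_nonneg jump_density_nonneg)
  have le: "jump_exponent b v \<le> 2 * m" for v
    unfolding m_def by (rule jump_exponent_le_mass)
  show ?thesis
  proof (cases "m = 0")
    \<comment> \<open>If the mass vanished, the exponent would be 0 and the Dirac mass would do;
      this is shorter than proving the mass positive.\<close>
    case True
    then have "jump_exponent b v = 0" for v using le[of v] jump_exponent_nonneg[of b v] by simp
    then show ?thesis using real_distribution_return[of 0] char_return_0 by (intro exI[of _ "return borel 0"]) auto
  next
    case False
    with m0 have m: "0 < m" by simp
    define f where "f x = jump_density b x / m" for x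
    have [measurable]: "f \<in> borel_measurable borel" unfolding f_def[abs_def] by measurable
    have f0: "0 \<le> f x" for x using jump_density_nonneg[of b x] m by (simp add: f_def)
    define J where "J = density lborel f"
    have "(\<integral>\<^sup>+x. f x \<partial>lborel) = ennreal (\<integral>x. f x \<partial>lborel)"
      using integrable_jump_density[of b] f0 by (intro nn_integral_eq_integral) (auto simp: f_def)
    also have "\<dots> = 1" using m by (simp add: f_def m_def)
    finally have "prob_space J" unfolding J_def
      by (intro prob_spaceI) (simp add: emeasure_density)
    then have J: "real_distribution J"
      by (simp add: real_distribution_def real_distribution_axioms_def J_def)
    have "(\<integral>x. cos (v * x) \<partial>J) = 1 - jump_exponent b v / m" for v
    proof -
      have "(\<integral>x. cos (v * x) \<partial>J) = (\<integral>x. f x * cos (v * x) \<partial>lborel)"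
        unfolding J_def using f0 by (subst integral_density) auto
      also have "\<dots> = (\<integral>x. f x - (1 - cos (v * x)) * jump_density b x / m \<partial>lborel)"
        using m by (intro Bochner_Integration.integral_cong) (auto simp: f_def field_simps)
      also have "\<dots> = (\<integral>x. f x \<partial>lborel) - jump_exponent b v / m"
        using integrable_jump_density[of b] integrable_jump_exponent[of v b]
        by (subst Bochner_Integration.integral_diff) (auto simp: f_def[abs_def] jump_exponent_def)
      also have "(\<integral>x. f x \<partial>lborel) = 1" using m by (simp add: f_def m_def)
      finally show ?thesis .
    qed
    moreover have "(\<integral>x. sin (v * x) \<partial>J) = 0" for v
      unfolding J_def using f0 integral_sin_even_eq_0[of f v]
      by (subst integral_density) (auto simp: f_def jump_density_even)
    ultimately have char_J: "char J v = of_real (1 - jump_exponent b v / m)" for v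
      unfolding real_distribution.char_eq_of_real_iff[OF J] by simp
    define M where "M = distr J borel (\<lambda>x. x / U)"
    have [measurable_cong]: "sets J = sets borel" by (simp add: J_def)
    have M: "real_distribution M"
      unfolding M_def using J by (auto simp: real_distribution_def real_distribution_axioms_def intro!: prob_space.prob_space_distr)
    have "char M u = of_real (1 - jump_exponent b (u / U) / m)" for u
      unfolding char_J[symmetric] M_def char_def by (subst integral_distr) auto
    from compound_poisson_exists[OF M _ this, of "s * m"] assms m
    show ?thesis by (simp add: algebra_simps)
  qed
qed

text \<open>The factor in front is chosen such that the two exponents differ on \<open>[-U, U]\<close> exactly by the
  exponent of a Gaussian law of variance \<open>\<delta>\<close>.\<close>

definition noise_exponent :: "bool \<Rightarrow> real \<Rightarrow> real \<Rightarrow> real \<Rightarrow> real" where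
  "noise_exponent b \<delta> U u = \<delta> * U\<^sup>2 / (12 * cos_kappa) * jump_exponent b (u / U)"

lemma noise_law_exists:
  assumes "0 \<le> \<delta>" "0 < U"
  shows "\<exists>N. real_distribution N \<and> (\<forall>u. char N u = of_real (exp (- noise_exponent b \<delta> U u)))"
  using jump_law_exists[of "\<delta> * U\<^sup>2 / (12 * cos_kappa)" U b] assms cos_kappa_pos
  by (simp add: noise_exponent_def)

lemma noise_exponent_nonneg: "0 \<le> \<delta> \<Longrightarrow> 0 \<le> noise_exponent b \<delta> U u"
  unfolding noise_exponent_def using cos_kappa_pos by (intro mult_nonneg_nonneg jump_exponent_nonneg) auto

lemma noise_exponent_diff:
  assumes "0 < U" "\<bar>u\<bar> \<le> U"
  shows "noise_exponent True \<delta> U u - noise_exponent False \<delta> U u = \<delta> * u\<^sup>2 / 2"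
proof -
  have "\<bar>u / U\<bar> \<le> 1" using assms by simp
  from jump_exponent_diff[OF this] show ?thesis
    using assms cos_kappa_pos unfolding noise_exponent_def right_diff_distrib[symmetric]
    by (simp add: power_divide)
qed

lemma noise_exponent_le_square:
  assumes "0 \<le> \<delta>" "0 < U"
  shows "noise_exponent b \<delta> U u \<le> jump_const / (12 * cos_kappa) * \<delta> * u\<^sup>2"
proof -
  have "noise_exponent b \<delta> U u \<le> \<delta> * U\<^sup>2 / (12 * cos_kappa) * (jump_const * (u / U)\<^sup>2)"
    unfolding noise_exponent_def using assms cos_kappa_pos by (intro mult_left_mono jump_exponent_le_square) auto
  also have "\<dots> = jump_const / (12 * cos_kappa) * \<delta> * u\<^sup>2"
    using assms by (simp add: power_divide)
  finally show ?thesis .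
qed

text \<open>The intensity contributes \<open>U\<^sup>2\<close> and the scale of the jumps
  \<open>U powr (- \<beta>)\<close>. Their product with \<delta> is the quantity that the noise
  class compares with \<open>T\<close>.\<close>

lemma noise_exponent_le_powr:
  assumes "0 \<le> \<delta>" "0 < U" "0 < \<beta>" "\<beta> < 2"
  shows "noise_exponent b \<delta> U u \<le> jump_const / (12 * cos_kappa) * (\<delta> * U powr (2 - \<beta>)) * \<bar>u\<bar> powr \<beta>"
proof -
  have "noise_exponent b \<delta> U u \<le> \<delta> * U\<^sup>2 / (12 * cos_kappa) * (jump_const * \<bar>u / U\<bar> powr \<beta>)"
    unfolding noise_exponent_def using assms cos_kappa_pos by (intro mult_left_mono jump_exponent_le_powr) auto
  also have "\<bar>u / U\<bar> powr \<beta> = \<bar>u\<bar> powr \<beta> / U powr \<beta>"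
    using assms by (simp add: powr_divide)
  also have "U\<^sup>2 = U powr (2 - \<beta>) * U powr \<beta>"
    using assms by (simp add: powr_add[symmetric] powr_numeral)
  finally show ?thesis using assms by (simp add: field_simps)
qed

section \<open>Total variation\<close>

text \<open>For probability measures this is total variation distance at most \<open>t\<close>: the
  one-sided inequality applied to \<open>1 - h\<close> yields the other side. Test functions replace
  events because integrating out one coordinate of a product turns a test function into a test
  function, but an event into none.\<close>

definition tv_close :: "'a measure \<Rightarrow> 'a measure \<Rightarrow> ennreal \<Rightarrow> bool" where
  "tv_close M N t \<longleftrightarrow> sets M = sets N \<and>
     (\<forall>h \<in> borel_measurable M. (\<forall>x. h x \<le> 1) \<longrightarrow> (\<integral>\<^sup>+x. h x \<partial>M) \<le> (\<integral>\<^sup>+x. h x \<partial>N) + t)"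

lemma tv_closeD:
  assumes "tv_close M N t" "h \<in> borel_measurable M" "\<And>x. h x \<le> 1"
  shows "(\<integral>\<^sup>+x. h x \<partial>M) \<le> (\<integral>\<^sup>+x. h x \<partial>N) + t"
  using assms by (auto simp: tv_close_def)

lemma tv_close_refl: "tv_close M M 0"
  by (simp add: tv_close_def)

lemma tv_close_mono: "tv_close M N s \<Longrightarrow> s \<le> t \<Longrightarrow> tv_close M N t"
  unfolding tv_close_def by (meson add_left_mono order_trans)

text \<open>The factors are exchanged one at a time, each at the price \<open>t i\<close>.\<close>

lemma tv_close_PiM:
  fixes M N :: "'i \<Rightarrow> 'a measure"
  assumes "finite I" "\<And>i. prob_space (M i)" "\<And>i. prob_space (N i)" "\<And>i. tv_close (M i) (N i) (t i)"
  shows "tv_close (PiM I M) (PiM I N) (\<Sum>i\<in>I. t i)"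
  using \<open>finite I\<close>
proof (induction I rule: finite_induct)
  case empty
  have "PiM {} M = PiM {} N" by (simp add: PiM_empty)
  then show ?case by (simp add: tv_close_refl)
next
  case (insert i I)
  interpret M: product_prob_space M using assms(2) by (simp add: product_prob_space_def product_prob_space_axioms_def product_sigma_finite_def prob_space_imp_sigma_finite)
  interpret N: product_prob_space N using assms(3) by (simp add: product_prob_space_def product_prob_space_axioms_def product_sigma_finite_def prob_space_imp_sigma_finite)
  have [measurable_cong]: "sets (M i) = sets (N i)" for i using assms(4) by (simp add: tv_close_def)
  have s: "sets (PiM J M) = sets (PiM J N)" for J by (intro sets_PiM_cong) (auto simp: \<open>\<And>i. sets (M i) = sets (N i)\<close>)
  interpret PM: prob_space "PiM I M" by (rule prob_space_PiM) (rule assms(2))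
  show ?case unfolding tv_close_def
  proof (intro conjI s ballI impI)
    fix h :: "('i \<Rightarrow> 'a) \<Rightarrow> ennreal"
    assume h: "h \<in> borel_measurable (PiM (insert i I) M)" and le: "\<forall>x. h x \<le> 1"
    have h': "h \<in> borel_measurable (PiM (insert i I) N)" using h by (simp add: measurable_cong_sets[OF s refl])
    note [measurable] = h h'
    have m: "(\<lambda>y. h (x(i := y))) \<in> borel_measurable (M i)" if "x \<in> space (PiM I M)" for x
      using that by measurable
    \<comment> \<open>The new coordinate is averaged under its final law \<open>N i\<close>; the
      result is still bounded by 1, hence admissible in the induction hypothesis.\<close>
    define g where "g x = (\<integral>\<^sup>+y. h (x(i := y)) \<partial>N i)" for x
    have g1: "g x \<le> 1" for x
    proof -
      have "g x \<le> (\<integral>\<^sup>+y. 1 \<partial>N i)" unfolding g_def using le by (intro nn_integral_mono) auto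
      also have "\<dots> = 1" using prob_space.emeasure_space_1[OF assms(3)] by simp
      finally show ?thesis .
    qed
    have gN: "g \<in> borel_measurable (PiM I N)"
      unfolding g_def by measurable
    then have gM: "g \<in> borel_measurable (PiM I M)" by (simp add: measurable_cong_sets[OF s refl])
    have "(\<integral>\<^sup>+x. h x \<partial>PiM (insert i I) M) = (\<integral>\<^sup>+x. (\<integral>\<^sup>+y. h (x(i := y)) \<partial>M i) \<partial>PiM I M)"
      by (rule M.product_nn_integral_insert) (use insert h in auto)
    also have "\<dots> \<le> (\<integral>\<^sup>+x. g x + t i \<partial>PiM I M)"
      unfolding g_def using le by (intro nn_integral_mono tv_closeD[OF assms(4)] m) auto
    also have "\<dots> = (\<integral>\<^sup>+x. g x \<partial>PiM I M) + t i"
      using gM by (subst nn_integral_add) (auto simp: PM.emeasure_space_1)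
    also have "\<dots> \<le> ((\<integral>\<^sup>+x. g x \<partial>PiM I N) + (\<Sum>i\<in>I. t i)) + t i"
      by (intro add_right_mono tv_closeD[OF insert.IH] gM g1)
    also have "(\<integral>\<^sup>+x. g x \<partial>PiM I N) = (\<integral>\<^sup>+x. h x \<partial>PiM (insert i I) N)"
      unfolding g_def by (rule N.product_nn_integral_insert[symmetric]) (use insert h' in auto)
    finally show "(\<integral>\<^sup>+x. h x \<partial>PiM (insert i I) M) \<le> (\<integral>\<^sup>+x. h x \<partial>PiM (insert i I) N) + (\<Sum>i\<in>insert i I. t i)"
      using insert by (simp add: ac_simps)
  qed
qed

section \<open>Gaussian smoothing\<close>

abbreviation gauss :: "real \<Rightarrow> real measure" where
  "gauss \<sigma> \<equiv> density lborel (normal_density 0 \<sigma>)"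

lemma real_distribution_gauss: "0 < \<sigma> \<Longrightarrow> real_distribution (gauss \<sigma>)"
  by (simp add: real_distribution_def real_distribution_axioms_def prob_space_normal_density)

lemma integral_cos_std_normal: "(\<integral>z. std_normal_density z * cos (t * z) \<partial>lborel) = exp (- t\<^sup>2 / 2)"
proof -
  interpret real_distribution "gauss 1" by (rule real_distribution_gauss) simp
  have "exp (- t\<^sup>2 / 2) = (\<integral>z. cos (t * z) \<partial>gauss 1)"
    unfolding Re_char[symmetric] by (simp add: char_std_normal_distribution)
  then show ?thesis by (subst (asm) integral_density) auto
qed

text \<open>The Gaussian is its own Fourier transform up to scaling: the transform of the standard
  normal density is read at \<open>y / \<sigma>\<close> and the variable is rescaled by
  \<sigma>.\<close>

lemma integral_cos_gauss:
  assumes "0 < \<sigma>"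
  shows "(\<integral>u. cos (u * y) * exp (- (\<sigma> * u)\<^sup>2 / 2) \<partial>lborel) = 2 * pi * normal_density 0 \<sigma> y"
proof -
  have "exp (- (y / \<sigma>)\<^sup>2 / 2) = (\<integral>z. std_normal_density z * cos (y / \<sigma> * z) \<partial>lborel)"
    by (rule integral_cos_std_normal[symmetric])
  also have "\<dots> = \<bar>\<sigma>\<bar> *\<^sub>R (\<integral>u. std_normal_density (0 + \<sigma> * u) * cos (y / \<sigma> * (0 + \<sigma> * u)) \<partial>lborel)"
    by (rule lborel_integral_real_affine) (use assms in simp)
  also have "\<dots> = \<sigma> * (\<integral>u. cos (u * y) * exp (- (\<sigma> * u)\<^sup>2 / 2) / sqrt (2 * pi) \<partial>lborel)"
    using assms by (simp add: std_normal_density_def mult.commute)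
  finally have *: "(\<integral>u. cos (u * y) * exp (- (\<sigma> * u)\<^sup>2 / 2) \<partial>lborel) = sqrt (2 * pi) / \<sigma> * exp (- (y / \<sigma>)\<^sup>2 / 2)"
    using assms by (simp add: field_simps)
  have "sqrt (2 * pi * \<sigma>\<^sup>2) = sqrt (2 * pi) * \<sigma>" using assms by (simp add: real_sqrt_mult)
  then have "2 * pi * normal_density 0 \<sigma> y = 2 * pi / (sqrt (2 * pi) * \<sigma>) * exp (- (y / \<sigma>)\<^sup>2 / 2)"
    by (simp add: normal_density_def power_divide)
  also have "2 * pi / (sqrt (2 * pi) * \<sigma>) = sqrt (2 * pi) / \<sigma>"
    using assms real_sqrt_mult_self[of "2 * pi"] by (simp add: field_simps)
  finally show ?thesis using * by simp
qed

lemma integral_exp_square: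
  assumes "0 < \<sigma>"
  shows "integrable lborel (\<lambda>u. exp (- (\<sigma> * u)\<^sup>2 / 2))"
    and "(\<integral>u. exp (- (\<sigma> * u)\<^sup>2 / 2) \<partial>lborel) = sqrt (2 * pi) / \<sigma>"
proof -
  have e: "exp (- (\<sigma> * u)\<^sup>2 / 2) = sqrt (2 * pi) / \<sigma> * normal_density 0 (1 / \<sigma>) u" for u
    using assms by (simp add: normal_density_def power_mult_distrib power_divide real_sqrt_divide real_sqrt_mult)
  show "integrable lborel (\<lambda>u. exp (- (\<sigma> * u)\<^sup>2 / 2))" unfolding e using assms by (intro integrable_mult_right integrable_normal_density) simp
  show "(\<integral>u. exp (- (\<sigma> * u)\<^sup>2 / 2) \<partial>lborel) = sqrt (2 * pi) / \<sigma>" unfolding e using assms by simp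
qed

lemma char_gauss:
  assumes "0 < \<sigma>"
  shows "char (gauss \<sigma>) t = of_real (exp (- (\<sigma> * t)\<^sup>2 / 2))"
proof -
  interpret real_distribution "gauss \<sigma>" by (rule real_distribution_gauss) fact
  have "(\<integral>x. sin (t * x) \<partial>gauss \<sigma>) = 0"
    using integral_sin_even_eq_0[of "normal_density 0 \<sigma>" t]
    by (subst integral_density) (auto simp: normal_density_def)
  moreover have "(\<integral>x. cos (t * x) \<partial>gauss \<sigma>) = exp (- (\<sigma> * t)\<^sup>2 / 2)"
  proof -
    have "(\<integral>x. cos (t * x) \<partial>gauss \<sigma>) = (\<integral>x. normal_density 0 \<sigma> x * cos (t * x) \<partial>lborel)"
      by (subst integral_density) auto
    also have "\<dots> = \<bar>\<sigma>\<bar> *\<^sub>R (\<integral>z. normal_density 0 \<sigma> (0 + \<sigma> * z) * cos (t * (0 + \<sigma> * z)) \<partial>lborel)"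
      by (rule lborel_integral_real_affine) (use assms in simp)
    also have "\<dots> = (\<integral>z. std_normal_density z * cos ((\<sigma> * t) * z) \<partial>lborel)"
      using assms by (subst Bochner_Integration.integral_scaleR_right[symmetric])
        (auto intro!: Bochner_Integration.integral_cong simp: normal_density_def real_sqrt_mult power_mult_distrib ac_simps)
    finally show ?thesis by (simp add: integral_cos_std_normal)
  qed
  ultimately show ?thesis by (simp add: char_eq_of_real_iff)
qed

text \<open>The Lebesgue density of \<open>gauss \<sigma> \<star> \<nu>\<close>. It exists for every
  law \<open>\<nu>\<close>, also for compound Poisson noise, which has an atom at 0.\<close>

definition smooth_density :: "real \<Rightarrow> real measure \<Rightarrow> real \<Rightarrow> real" where
  "smooth_density \<sigma> \<nu> y = (\<integral>e. normal_density 0 \<sigma> (y - e) \<partial>\<nu>)"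

lemma normal_density_le: "0 < \<sigma> \<Longrightarrow> normal_density 0 \<sigma> x \<le> 1 / sqrt (2 * pi * \<sigma>\<^sup>2)"
  unfolding normal_density_def by (intro mult_left_le) auto

lemma smooth_density_measurable [measurable]:
  assumes "real_distribution \<nu>"
  shows "smooth_density \<sigma> \<nu> \<in> borel_measurable borel"
proof -
  interpret real_distribution \<nu> by fact
  show ?thesis unfolding smooth_density_def[abs_def] by measurable
qed

lemma smooth_density_nonneg: "0 \<le> smooth_density \<sigma> \<nu> y"
  unfolding smooth_density_def by (rule Bochner_Integration.integral_nonneg) simp

lemma nn_integral_gauss_convolution:
  assumes "0 < \<sigma>" "real_distribution \<nu>" and [measurable]: "h \<in> borel_measurable borel"
  shows "(\<integral>\<^sup>+y. h y \<partial>(gauss \<sigma> \<star> \<nu>)) = (\<integral>\<^sup>+y. h y * smooth_density \<sigma> \<nu> y \<partial>lborel)"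
proof -
  interpret nu: real_distribution \<nu> by fact
  interpret g: real_distribution "gauss \<sigma>" by (rule real_distribution_gauss) fact
  interpret pair_sigma_finite lborel \<nu> ..
  let ?n = "normal_density 0 \<sigma>"
  have "(\<integral>\<^sup>+y. h y \<partial>(gauss \<sigma> \<star> \<nu>)) = (\<integral>\<^sup>+x. \<integral>\<^sup>+e. h (x + e) \<partial>\<nu> \<partial>gauss \<sigma>)"
    by (rule nn_integral_convolution) (auto intro: g.finite_measure_axioms nu.finite_measure_axioms)
  also have "\<dots> = (\<integral>\<^sup>+x. \<integral>\<^sup>+e. ?n x * h (x + e) \<partial>\<nu> \<partial>lborel)"
    by (simp add: nn_integral_density nn_integral_cmult)
  also have "\<dots> = (\<integral>\<^sup>+e. \<integral>\<^sup>+x. ?n x * h (x + e) \<partial>lborel \<partial>\<nu>)"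
    by (rule Fubini'[symmetric]) measurable
  also have "\<dots> = (\<integral>\<^sup>+e. \<integral>\<^sup>+y. ?n (y - e) * h y \<partial>lborel \<partial>\<nu>)"
  proof (rule nn_integral_cong)
    fix e
    show "(\<integral>\<^sup>+x. ?n x * h (x + e) \<partial>lborel) = (\<integral>\<^sup>+y. ?n (y - e) * h y \<partial>lborel)"
      by (subst nn_integral_real_affine[where c=1 and t="-e"]) auto
  qed
  also have "\<dots> = (\<integral>\<^sup>+y. \<integral>\<^sup>+e. ?n (y - e) * h y \<partial>\<nu> \<partial>lborel)"
    by (rule Fubini') measurable
  also have "\<dots> = (\<integral>\<^sup>+y. h y * smooth_density \<sigma> \<nu> y \<partial>lborel)"
  proof (rule nn_integral_cong)
    fix y
    have "(\<integral>\<^sup>+e. ?n (y - e) * h y \<partial>\<nu>) = (\<integral>\<^sup>+e. ?n (y - e) \<partial>\<nu>) * h y"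
      by (rule nn_integral_multc) simp
    also have "(\<integral>\<^sup>+e. ?n (y - e) \<partial>\<nu>) = ennreal (smooth_density \<sigma> \<nu> y)"
      unfolding smooth_density_def
      by (intro nn_integral_eq_integral nu.integrable_const_bound[of _ "1 / sqrt (2 * pi * \<sigma>\<^sup>2)"])
         (use normal_density_le assms(1) in auto)
    finally show "(\<integral>\<^sup>+e. ?n (y - e) * h y \<partial>\<nu>) = h y * smooth_density \<sigma> \<nu> y" by (simp add: mult.commute)
  qed
  finally show ?thesis .
qed

text \<open>The normal density is replaced by its own inversion integral and the integrals are
  exchanged. The Gaussian factor dominates in \<open>u\<close>, so Fubini applies even when
  \<open>g\<close> does not decay, as for compound Poisson noise.\<close>

lemma smooth_density_inversion:
  assumes "0 < \<sigma>" "real_distribution \<nu>" and char: "\<And>u. char \<nu> u = of_real (g u)"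
  shows "integrable lborel (\<lambda>u. cos (u * y) * (exp (- (\<sigma> * u)\<^sup>2 / 2) * g u))"
    and "2 * pi * smooth_density \<sigma> \<nu> y = (\<integral>u. cos (u * y) * (exp (- (\<sigma> * u)\<^sup>2 / 2) * g u) \<partial>lborel)"
proof -
  interpret nu: real_distribution \<nu> by fact
  interpret pair_sigma_finite lborel \<nu> ..
  let ?F = "\<lambda>u e. exp (- (\<sigma> * u)\<^sup>2 / 2) * cos (u * (y - e))"
  have int: "integrable (lborel \<Otimes>\<^sub>M \<nu>) (\<lambda>(u, e). ?F u e)"
  proof (rule Bochner_Integration.integrable_bound)
    show "integrable (lborel \<Otimes>\<^sub>M \<nu>) (\<lambda>(u, e). exp (- (\<sigma> * u)\<^sup>2 / 2))"
      by (rule Fubini_integrable) (use integral_exp_square(1)[OF assms(1)] in \<open>auto simp: nu.prob_space\<close>)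
  qed (auto simp: abs_mult intro!: AE_I2)
  have inner: "(\<integral>e. ?F u e \<partial>\<nu>) = cos (u * y) * (exp (- (\<sigma> * u)\<^sup>2 / 2) * g u)" for u
  proof -
    have "integrable \<nu> (\<lambda>e. cos (u * e))" "integrable \<nu> (\<lambda>e. sin (u * e))"
      by (auto intro!: nu.integrable_const_bound[of _ 1])
    then have "(\<integral>e. cos (u * y) * cos (u * e) + sin (u * y) * sin (u * e) \<partial>\<nu>) = cos (u * y) * g u"
      using nu.char_eq_of_real_iff[of u "g u"] char by simp
    then have "(\<integral>e. cos (u * (y - e)) \<partial>\<nu>) = cos (u * y) * g u"
      by (simp add: right_diff_distrib cos_diff)
    then show ?thesis by simp
  qed
  show "integrable lborel (\<lambda>u. cos (u * y) * (exp (- (\<sigma> * u)\<^sup>2 / 2) * g u))"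
    using integrable_fst[OF int] by (simp only: inner)
  have "2 * pi * smooth_density \<sigma> \<nu> y = (\<integral>e. 2 * pi * normal_density 0 \<sigma> (y - e) \<partial>\<nu>)"
    by (simp add: smooth_density_def)
  also have "\<dots> = (\<integral>e. (\<integral>u. ?F u e \<partial>lborel) \<partial>\<nu>)"
    by (simp only: integral_cos_gauss[OF assms(1), symmetric] mult.commute[of "exp _"])
  also have "\<dots> = (\<integral>u. (\<integral>e. ?F u e \<partial>\<nu>) \<partial>lborel)"
    by (rule Fubini_integral[OF int])
  finally show "2 * pi * smooth_density \<sigma> \<nu> y = (\<integral>u. cos (u * y) * (exp (- (\<sigma> * u)\<^sup>2 / 2) * g u) \<partial>lborel)"
    by (simp only: inner)
qed

text \<open>Testing against the Gaussian \<open>exp (- y\<^sup>2 / (2 * M\<^sup>2))\<close> turns the behaviour of the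
  characteristic function at the origin into a tail bound.\<close>

lemma gauss_tail_le:
  assumes "real_distribution Q" "0 < M" "\<And>u. char Q u = of_real (G u)" "\<And>u. 1 - G u \<le> B * u\<^sup>2"
  shows "(\<integral>\<^sup>+y. ennreal (1 - exp (- (y / M)\<^sup>2 / 2)) \<partial>Q) \<le> ennreal (B / M\<^sup>2)"
proof -
  interpret Q: real_distribution Q by fact
  interpret N: real_distribution "gauss 1" by (rule real_distribution_gauss) simp
  interpret pair_prob_space Q "gauss 1" ..
  have [measurable]: "G \<in> borel_measurable borel"
  proof -
    have "G = (\<lambda>u. Re (char Q u))" using assms(3) by auto
    then show ?thesis by simp
  qed
  have cos: "(\<integral>z. cos (t * z) \<partial>gauss 1) = exp (- t\<^sup>2 / 2)" for t
    using integral_cos_std_normal[of t] by (subst integral_density) auto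
  have int: "integrable (Q \<Otimes>\<^sub>M gauss 1) (\<lambda>(y, z). 1 - cos (y / M * z))"
  proof (intro integrable_const_bound[of _ 2] AE_I2)
    fix p :: "real \<times> real"
    show "norm (case p of (y, z) \<Rightarrow> 1 - cos (y / M * z)) \<le> 2"
      using cos_ge_minus_one[of "fst p / M * snd p"] by (auto simp: split_beta simp del: cos_ge_minus_one)
  qed simp
  have i1: "(\<integral>z. 1 - cos (t * z) \<partial>gauss 1) = 1 - exp (- t\<^sup>2 / 2)" for t
  proof -
    have "integrable (gauss 1) (\<lambda>z. cos (t * z))" by (intro N.integrable_const_bound[of _ 1]) auto
    then show ?thesis using N.prob_space by (subst Bochner_Integration.integral_diff) (auto simp: cos)
  qed
  have i2: "integrable Q (\<lambda>z. cos (t * z))" for t by (intro Q.integrable_const_bound[of _ 1]) auto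
  have "(\<integral>\<^sup>+y. ennreal (1 - exp (- (y / M)\<^sup>2 / 2)) \<partial>Q) = ennreal (\<integral>y. 1 - exp (- (y / M)\<^sup>2 / 2) \<partial>Q)"
    by (intro nn_integral_eq_integral Q.integrable_const_bound[of _ 1]) auto
  \<comment> \<open>The weight is written as a standard Gaussian average of cosines; after Fubini
    the integral becomes the average of \<open>1 - G (z / M)\<close>, and the second moment of
    \<open>z\<close> is 1.\<close>
  also have "(\<integral>y. 1 - exp (- (y / M)\<^sup>2 / 2) \<partial>Q) = (\<integral>y. (\<integral>z. 1 - cos (y / M * z) \<partial>gauss 1) \<partial>Q)"
    by (simp only: i1)
  also have "\<dots> = (\<integral>z. (\<integral>y. 1 - cos (y / M * z) \<partial>Q) \<partial>gauss 1)"
    by (rule Fubini_integral[OF int, symmetric])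
  also have "\<dots> = (\<integral>z. 1 - G (z / M) \<partial>gauss 1)"
  proof (intro Bochner_Integration.integral_cong refl)
    fix z
    have "(\<integral>y. 1 - cos (y / M * z) \<partial>Q) = (\<integral>y. 1 - cos (z / M * y) \<partial>Q)" by (simp add: mult.commute)
    also have "\<dots> = 1 - (\<integral>y. cos (z / M * y) \<partial>Q)"
      using i2[of "z / M"] Q.prob_space by (subst Bochner_Integration.integral_diff) auto
    also have "(\<integral>y. cos (z / M * y) \<partial>Q) = G (z / M)"
      using Q.char_eq_of_real_iff[of "z / M" "G (z / M)"] assms(3) by simp
    finally show "(\<integral>y. 1 - cos (y / M * z) \<partial>Q) = 1 - G (z / M)" .
  qed
  also have "\<dots> \<le> (\<integral>z. B / M\<^sup>2 * z\<^sup>2 \<partial>gauss 1)"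
  proof (intro integral_mono)
    show "integrable (gauss 1) (\<lambda>z. 1 - G (z / M))"
    proof (intro N.integrable_const_bound[of _ 2] AE_I2)
      fix z
      have "\<bar>G (z / M)\<bar> \<le> 1" using Q.cmod_char_le_1[of "z / M"] assms(3) by simp
      then show "norm (1 - G (z / M)) \<le> 2" by simp
    qed simp
    show "integrable (gauss 1) (\<lambda>z. B / M\<^sup>2 * z\<^sup>2)" using integrable_std_normal_distribution_moment[of 2] by simp
    show "1 - G (z / M) \<le> B / M\<^sup>2 * z\<^sup>2" for z using assms(4)[of "z / M"] by (simp add: power_divide)
  qed
  also have "\<dots> = B / M\<^sup>2"
    using std_normal_distribution_even_moments(1)[of 1] by (simp add: fact_numeral numeral_2_eq_2)
  finally show ?thesis by (simp add: ennreal_leI)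
qed

text \<open>Inversion bounds the difference of the two densities uniformly, since only frequencies
  beyond \<open>U\<close> contribute. Multiplying the test by a Gaussian weight of width
  \<open>M\<close> makes the uniform bound integrable; what the weight removes is charged to
  \<open>gauss_tail_le\<close>. Because the inequality is one-sided, the behaviour at the origin
  enters for the first law only.\<close>

lemma tv_close_gauss_convolution:
  assumes s: "0 < \<sigma>" "0 < \<tau>" "r \<le> \<sigma>\<^sup>2" "r \<le> \<tau>\<^sup>2" "0 < r"
    and nu: "real_distribution \<nu>" "real_distribution \<mu>"
    and char: "\<And>u. char \<nu> u = of_real (g u)" "\<And>u. char \<mu> u = of_real (f u)"
    and range: "\<And>u. 0 \<le> g u" "\<And>u. g u \<le> 1" "\<And>u. 0 \<le> f u" "\<And>u. f u \<le> 1"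
    and agree: "\<And>u. \<bar>u\<bar> \<le> U \<Longrightarrow> exp (- (\<sigma> * u)\<^sup>2 / 2) * g u = exp (- (\<tau> * u)\<^sup>2 / 2) * f u"
    and origin: "\<And>u. 1 - exp (- (\<sigma> * u)\<^sup>2 / 2) * g u \<le> B * u\<^sup>2"
    and pos: "0 < M" "0 < U" "0 \<le> B"
  shows "tv_close (gauss \<sigma> \<star> \<nu>) (gauss \<tau> \<star> \<mu>) (ennreal (B / M\<^sup>2 + M * sqrt (2 / r) * exp (- r * U\<^sup>2 / 4)))"
proof -
  let ?F = "\<lambda>u. exp (- (\<sigma> * u)\<^sup>2 / 2) * g u" and ?G = "\<lambda>u. exp (- (\<tau> * u)\<^sup>2 / 2) * f u"
  let ?w = "\<lambda>y. exp (- (y / M)\<^sup>2 / 2)"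
  define \<epsilon> where "\<epsilon> = exp (- r * U\<^sup>2 / 4) / sqrt (pi * r)"
  have "0 \<le> \<epsilon>" unfolding \<epsilon>_def using s by simp
  note [measurable] = smooth_density_measurable[OF nu(1)] smooth_density_measurable[OF nu(2)]
  have sup: "smooth_density \<sigma> \<nu> y \<le> smooth_density \<tau> \<mu> y + \<epsilon>" for y
  proof -
    \<comment> \<open>Half of the exponent \<open>r * u\<^sup>2 / 2\<close> is spent on the factor
      \<open>exp (- r * U\<^sup>2 / 4)\<close>; the other half is \<open>(e * u)\<^sup>2 / 2\<close>
      and keeps the bound integrable.\<close>
    define e where "e = sqrt (r / 2)"
    have e: "0 < e" "e\<^sup>2 = r / 2" using s by (auto simp: e_def)
    have int: "integrable lborel (\<lambda>u. cos (u * y) * ?F u)" "integrable lborel (\<lambda>u. cos (u * y) * ?G u)"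
      by (rule smooth_density_inversion(1)[OF s(1) nu(1) char(1)], rule smooth_density_inversion(1)[OF s(2) nu(2) char(2)])
    have bound: "cos (u * y) * ?F u - cos (u * y) * ?G u \<le> exp (- r * U\<^sup>2 / 4) * exp (- (e * u)\<^sup>2 / 2)" for u
    proof (cases "\<bar>u\<bar> \<le> U")
      case True
      then show ?thesis by (simp only: agree) simp
    next
      case False
      have H: "exp (- (\<rho> * u)\<^sup>2 / 2) * x \<le> exp (- r * U\<^sup>2 / 4) * exp (- (e * u)\<^sup>2 / 2)"
        if "0 \<le> x" "x \<le> 1" "r \<le> \<rho>\<^sup>2" for x \<rho>
      proof -
        have "U\<^sup>2 \<le> u\<^sup>2" using False pos by (intro abs_le_square_iff[THEN iffD1]) auto
        then have "r * U\<^sup>2 \<le> r * u\<^sup>2" "r * u\<^sup>2 \<le> \<rho>\<^sup>2 * u\<^sup>2"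
          using s that by (auto intro: mult_left_mono mult_right_mono)
        then have "exp (- (\<rho> * u)\<^sup>2 / 2) \<le> exp (- r * U\<^sup>2 / 4 + - (e * u)\<^sup>2 / 2)"
          unfolding exp_le_cancel_iff power_mult_distrib e(2) by (simp add: field_simps)
        then have "exp (- (\<rho> * u)\<^sup>2 / 2) * x \<le> exp (- r * U\<^sup>2 / 4 + - (e * u)\<^sup>2 / 2) * 1"
          using that by (intro mult_mono) auto
        then show ?thesis by (simp only: exp_add mult_1_right)
      qed
      \<comment> \<open>Both transforms lie between 0 and the bound, so their difference does too,
        without a factor 2.\<close>
      have "\<bar>?F u - ?G u\<bar> \<le> exp (- r * U\<^sup>2 / 4) * exp (- (e * u)\<^sup>2 / 2)"
      proof -
        have "0 \<le> ?F u" "0 \<le> ?G u" using range by (auto intro: mult_nonneg_nonneg)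
        moreover have "?F u \<le> exp (- r * U\<^sup>2 / 4) * exp (- (e * u)\<^sup>2 / 2)" by (rule H[OF range(1,2) s(3)])
        moreover have "?G u \<le> exp (- r * U\<^sup>2 / 4) * exp (- (e * u)\<^sup>2 / 2)" by (rule H[OF range(3,4) s(4)])
        ultimately show ?thesis unfolding abs_le_iff by linarith
      qed
      then have "\<bar>cos (u * y)\<bar> * \<bar>?F u - ?G u\<bar> \<le> 1 * (exp (- r * U\<^sup>2 / 4) * exp (- (e * u)\<^sup>2 / 2))"
        by (intro mult_mono) auto
      moreover have "cos (u * y) * (?F u - ?G u) \<le> \<bar>cos (u * y)\<bar> * \<bar>?F u - ?G u\<bar>"
        by (metis abs_ge_self abs_mult)
      ultimately show ?thesis unfolding right_diff_distrib[symmetric] mult_1 by (rule order_trans[rotated])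
    qed
    have "2 * pi * smooth_density \<sigma> \<nu> y - 2 * pi * smooth_density \<tau> \<mu> y
        = (\<integral>u. cos (u * y) * ?F u - cos (u * y) * ?G u \<partial>lborel)"
      unfolding smooth_density_inversion(2)[OF s(1) nu(1) char(1)] smooth_density_inversion(2)[OF s(2) nu(2) char(2)]
      by (rule Bochner_Integration.integral_diff[OF int, symmetric])
    also have "\<dots> \<le> (\<integral>u. exp (- r * U\<^sup>2 / 4) * exp (- (e * u)\<^sup>2 / 2) \<partial>lborel)"
      using int integral_exp_square(1)[OF e(1)] by (intro integral_mono bound) auto
    also have "\<dots> = exp (- r * U\<^sup>2 / 4) * (sqrt (2 * pi) / e)"
      using integral_exp_square(2)[OF e(1)] by simp
    also have "sqrt (2 * pi) / e = 2 * pi / sqrt (pi * r)"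
    proof -
      have "sqrt (2 * pi) * sqrt (pi * r) = sqrt ((2 * pi)\<^sup>2 * (r / 2))"
        by (simp add: real_sqrt_mult[symmetric] power2_eq_square ac_simps)
      also have "\<dots> = 2 * pi * e" unfolding real_sqrt_mult[of "(2 * pi)\<^sup>2"] real_sqrt_abs e_def by simp
      finally show ?thesis using s e by (simp add: field_simps)
    qed
    finally have "2 * pi * smooth_density \<sigma> \<nu> y \<le> 2 * pi * (smooth_density \<tau> \<mu> y + \<epsilon>)"
      by (simp add: \<epsilon>_def algebra_simps)
    then show ?thesis by simp
  qed
  have Q: "real_distribution (gauss \<sigma> \<star> \<nu>)" "\<And>u. char (gauss \<sigma> \<star> \<nu>) u = of_real (?F u)"
    using s nu char(1) by (auto simp: real_distribution_convolution real_distribution_gauss char_convolution char_gauss)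
  have w: "(\<integral>\<^sup>+y. ennreal (?w y) \<partial>lborel) = ennreal (M * sqrt (2 * pi))"
    using integral_exp_square[of "1 / M"] pos by (subst nn_integral_eq_integral) (auto simp: mult.commute)
  have w1: "?w y \<le> 1" for y by simp
  show ?thesis unfolding tv_close_def
  proof (intro conjI ballI impI)
    fix h :: "real \<Rightarrow> ennreal" assume "h \<in> borel_measurable (gauss \<sigma> \<star> \<nu>)" and h1: "\<forall>x. h x \<le> 1"
    then have [measurable]: "h \<in> borel_measurable borel" by simp
    have [measurable_cong]: "sets (gauss \<sigma> \<star> \<nu>) = sets borel" by simp
    have "(\<integral>\<^sup>+y. h y * ennreal (?w y) \<partial>(gauss \<sigma> \<star> \<nu>)) = (\<integral>\<^sup>+y. h y * ennreal (?w y) * smooth_density \<sigma> \<nu> y \<partial>lborel)"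
      by (rule nn_integral_gauss_convolution) (use s nu in auto)
    also have "\<dots> \<le> (\<integral>\<^sup>+y. h y * smooth_density \<tau> \<mu> y + ennreal \<epsilon> * ennreal (?w y) \<partial>lborel)"
    proof (rule nn_integral_mono)
      fix y
      have "h y * ennreal (?w y) * smooth_density \<sigma> \<nu> y \<le> h y * ennreal (?w y) * (smooth_density \<tau> \<mu> y + \<epsilon>)"
        using sup by (intro mult_left_mono ennreal_leI) auto
      also have "\<dots> = h y * ennreal (?w y) * smooth_density \<tau> \<mu> y + h y * (ennreal \<epsilon> * ennreal (?w y))"
        using \<open>0 \<le> \<epsilon>\<close> smooth_density_nonneg[of \<tau> \<mu> y] by (simp add: ennreal_plus algebra_simps)
      also have "\<dots> \<le> h y * 1 * smooth_density \<tau> \<mu> y + 1 * (ennreal \<epsilon> * ennreal (?w y))"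
        using h1 w1[of y] by (intro add_mono mult_mono mult_right_mono mult_left_mono) (auto simp: ennreal_le_1)
      finally show "h y * ennreal (?w y) * smooth_density \<sigma> \<nu> y \<le> h y * smooth_density \<tau> \<mu> y + ennreal \<epsilon> * ennreal (?w y)"
        by simp
    qed
    also have "\<dots> = (\<integral>\<^sup>+y. h y * smooth_density \<tau> \<mu> y \<partial>lborel) + ennreal \<epsilon> * ennreal (M * sqrt (2 * pi))"
      unfolding w[symmetric] by (simp add: nn_integral_add nn_integral_cmult)
    also have "(\<integral>\<^sup>+y. h y * smooth_density \<tau> \<mu> y \<partial>lborel) = (\<integral>\<^sup>+y. h y \<partial>(gauss \<tau> \<star> \<mu>))"
      by (rule nn_integral_gauss_convolution[symmetric]) (use s nu in auto)
    finally have J: "(\<integral>\<^sup>+y. h y * ennreal (?w y) \<partial>(gauss \<sigma> \<star> \<nu>)) \<le>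
       (\<integral>\<^sup>+y. h y \<partial>(gauss \<tau> \<star> \<mu>)) + ennreal \<epsilon> * ennreal (M * sqrt (2 * pi))" .
    have "(\<integral>\<^sup>+y. h y \<partial>(gauss \<sigma> \<star> \<nu>)) \<le> (\<integral>\<^sup>+y. ennreal (1 - ?w y) + h y * ennreal (?w y) \<partial>(gauss \<sigma> \<star> \<nu>))"
    proof (rule nn_integral_mono)
      fix y
      \<comment> \<open>The test is split by the weight, and \<open>h\<close> is replaced by 1 where
        the weight is missing.\<close>
      have "h y = h y * (ennreal (1 - ?w y) + ennreal (?w y))" using w1[of y] by (simp flip: ennreal_plus)
      also have "\<dots> \<le> 1 * ennreal (1 - ?w y) + h y * ennreal (?w y)"
        unfolding distrib_left using h1 by (intro add_mono mult_right_mono) auto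
      finally show "h y \<le> ennreal (1 - ?w y) + h y * ennreal (?w y)" by simp
    qed
    also have "\<dots> = (\<integral>\<^sup>+y. ennreal (1 - ?w y) \<partial>(gauss \<sigma> \<star> \<nu>)) + (\<integral>\<^sup>+y. h y * ennreal (?w y) \<partial>(gauss \<sigma> \<star> \<nu>))"
      by (rule nn_integral_add) measurable
    also have "\<dots> \<le> ennreal (B / M\<^sup>2) + (\<integral>\<^sup>+y. h y * ennreal (?w y) \<partial>(gauss \<sigma> \<star> \<nu>))"
      by (intro add_right_mono gauss_tail_le[OF Q(1) pos(1) Q(2) origin])
    also have "\<dots> \<le> ennreal (B / M\<^sup>2) + ((\<integral>\<^sup>+y. h y \<partial>(gauss \<tau> \<star> \<mu>)) + ennreal \<epsilon> * ennreal (M * sqrt (2 * pi)))"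
      by (rule add_left_mono) (rule J)
    also have "\<dots> = (\<integral>\<^sup>+y. h y \<partial>(gauss \<tau> \<star> \<mu>)) + ennreal (B / M\<^sup>2 + \<epsilon> * (M * sqrt (2 * pi)))"
      using \<open>0 \<le> \<epsilon>\<close> pos by (simp add: ennreal_plus ennreal_mult ac_simps)
    also have "\<epsilon> * (M * sqrt (2 * pi)) = M * sqrt (2 / r) * exp (- r * U\<^sup>2 / 4)"
      using s by (simp add: \<epsilon>_def real_sqrt_mult real_sqrt_divide)
    finally show "(\<integral>\<^sup>+y. h y \<partial>(gauss \<sigma> \<star> \<nu>)) \<le> (\<integral>\<^sup>+y. h y \<partial>(gauss \<tau> \<star> \<mu>))
        + ennreal (B / M\<^sup>2 + M * sqrt (2 / r) * exp (- r * U\<^sup>2 / 4))" .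
  qed simp
qed

section \<open>Product laws\<close>

lemma product_prob_spaceI: "(\<And>i. prob_space (M i)) \<Longrightarrow> product_prob_space M"
  by (simp add: product_prob_space_def product_prob_space_axioms_def product_sigma_finite_def prob_space_imp_sigma_finite)

text \<open>Applied at two levels: to the coordinates of one observation and to the observations of
  a sample. On boxes the indicator is a product, so both integrations factorise, and boxes determine
  a finite product law.\<close>

lemma distr_pair_PiM:
  assumes I: "finite I" and M: "\<And>i. prob_space (M i)" and N: "\<And>i. prob_space (N i)"
    and f [measurable]: "\<And>i. f i \<in> measurable (M i \<Otimes>\<^sub>M N i) (L i)"
  shows "distr (PiM I M \<Otimes>\<^sub>M PiM I N) (PiM I L) (\<lambda>(x, e). \<lambda>i\<in>I. f i (x i, e i)) =
    PiM I (\<lambda>i. distr (M i \<Otimes>\<^sub>M N i) (L i) (f i))" (is "?P = PiM I ?Q")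
proof -
  interpret M: product_prob_space M by (rule product_prob_spaceI) fact
  interpret N: product_prob_space N by (rule product_prob_spaceI) fact
  interpret PM: prob_space "PiM I M" by (rule prob_space_PiM) (rule M)
  interpret PN: prob_space "PiM I N" by (rule prob_space_PiM) (rule N)
  have sf: "sigma_finite_measure (PiM I N)" by (intro prob_space_imp_sigma_finite prob_space_PiM N)
  have pair: "pair_prob_space (M i) (N i)" for i
    by (simp add: pair_prob_space_def pair_sigma_finite_def M N prob_space_imp_sigma_finite)
  have Q: "prob_space (?Q i)" for i
  proof -
    interpret pair_prob_space "M i" "N i" by (rule pair)
    show ?thesis by (rule prob_space_distr) fact
  qed
  interpret Q: product_prob_space ?Q by (rule product_prob_spaceI) (rule Q)
  have g [measurable]: "(\<lambda>(x, e). \<lambda>i\<in>I. f i (x i, e i)) \<in> measurable (PiM I M \<Otimes>\<^sub>M PiM I N) (PiM I L)"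
    unfolding split_beta by (intro measurable_restrict) measurable
  show ?thesis
  proof (rule Q.PiM_eqI)
    show "sets ?P = sets (PiM I ?Q)" by (simp, intro sets_PiM_cong) auto
    fix A assume "\<And>i. i \<in> I \<Longrightarrow> A i \<in> sets (?Q i)"
    then have A [measurable]: "\<And>i. i \<in> I \<Longrightarrow> A i \<in> sets (L i)" by simp
    have E: "Pi\<^sub>E I A \<in> sets (PiM I L)" using A I by (intro sets_PiM_I_finite) auto
    have ind: "indicator (Pi\<^sub>E I A) (\<lambda>i\<in>I. f i (x i, e i)) = (\<Prod>i\<in>I. indicator (A i) (f i (x i, e i)) :: ennreal)" for x e
      using I by (auto simp: indicator_def PiE_iff intro!: prod.neutral[symmetric])
    have "emeasure ?P (Pi\<^sub>E I A) = (\<integral>\<^sup>+z. indicator (Pi\<^sub>E I A) z \<partial>?P)"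
      using E by simp
    also have "\<dots> = (\<integral>\<^sup>+z. indicator (Pi\<^sub>E I A) (case z of (x, e) \<Rightarrow> \<lambda>i\<in>I. f i (x i, e i)) \<partial>(PiM I M \<Otimes>\<^sub>M PiM I N))"
      using E by (intro nn_integral_distr g) simp
    also have "\<dots> = (\<integral>\<^sup>+x. \<integral>\<^sup>+e. indicator (Pi\<^sub>E I A) (\<lambda>i\<in>I. f i (x i, e i)) \<partial>PiM I N \<partial>PiM I M)"
      using E measurable_compose[OF g, of "indicator (Pi\<^sub>E I A)" borel] by (subst sigma_finite_measure.nn_integral_fst[OF sf, symmetric]) auto
    also have "\<dots> = (\<integral>\<^sup>+x. (\<Prod>i\<in>I. \<integral>\<^sup>+e. indicator (A i) (f i (x i, e)) \<partial>N i) \<partial>PiM I M)"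
    proof (rule nn_integral_cong)
      fix x assume x: "x \<in> space (PiM I M)"
      show "(\<integral>\<^sup>+e. indicator (Pi\<^sub>E I A) (\<lambda>i\<in>I. f i (x i, e i)) \<partial>PiM I N) = (\<Prod>i\<in>I. \<integral>\<^sup>+e. indicator (A i) (f i (x i, e)) \<partial>N i)"
        unfolding ind
      proof (rule N.product_nn_integral_prod[OF I])
        fix i assume i: "i \<in> I"
        then have [measurable]: "A i \<in> sets (L i)" "x i \<in> space (M i)" using A x by (auto simp: space_PiM)
        show "(\<lambda>e. indicator (A i) (f i (x i, e)) :: ennreal) \<in> borel_measurable (N i)" by measurable
      qed
    qed
    also have "\<dots> = (\<Prod>i\<in>I. \<integral>\<^sup>+x. \<integral>\<^sup>+e. indicator (A i) (f i (x, e)) \<partial>N i \<partial>M i)"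
    proof (rule M.product_nn_integral_prod[OF I])
      fix i assume i: "i \<in> I"
      interpret N: prob_space "N i" by fact
      have [measurable]: "A i \<in> sets (L i)" using A i by auto
      show "(\<lambda>x. \<integral>\<^sup>+e. indicator (A i) (f i (x, e)) \<partial>N i) \<in> borel_measurable (M i)" by measurable
    qed
    also have "\<dots> = (\<Prod>i\<in>I. emeasure (?Q i) (A i))"
    proof (rule prod.cong[OF refl])
      fix i assume i: "i \<in> I"
      interpret N: prob_space "N i" by fact
      have [measurable]: "A i \<in> sets (L i)" using A i by auto
      have "emeasure (?Q i) (A i) = (\<integral>\<^sup>+z. indicator (A i) z \<partial>?Q i)" by simp
      also have "\<dots> = (\<integral>\<^sup>+z. indicator (A i) (f i z) \<partial>(M i \<Otimes>\<^sub>M N i))"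
        by (rule nn_integral_distr) measurable
      also have "\<dots> = (\<integral>\<^sup>+x. \<integral>\<^sup>+e. indicator (A i) (f i (x, e)) \<partial>N i \<partial>M i)"
        by (rule sigma_finite_measure.nn_integral_fst[OF prob_space_imp_sigma_finite[OF N], symmetric]) measurable
      finally show "(\<integral>\<^sup>+x. \<integral>\<^sup>+e. indicator (A i) (f i (x, e)) \<partial>N i \<partial>M i) = emeasure (?Q i) (A i)" by simp
    qed
    finally show "emeasure ?P (Pi\<^sub>E I A) = (\<Prod>i\<in>I. emeasure (?Q i) (A i))" .
  qed fact
qed

lemma density_PiM_lborel:
  fixes F :: "'i \<Rightarrow> real \<Rightarrow> ennreal"
  assumes I: "finite I" and [measurable]: "\<And>i. F i \<in> borel_measurable borel"
    and P: "\<And>i. prob_space (density lborel (F i))"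
  shows "density (PiM I (\<lambda>_. lborel)) (\<lambda>x. \<Prod>i\<in>I. F i (x i)) = PiM I (\<lambda>i. density lborel (F i))"
proof -
  interpret P: product_prob_space "\<lambda>i. density lborel (F i)" by (rule product_prob_spaceI) (rule P)
  interpret L: product_sigma_finite "\<lambda>_::'i. lborel :: real measure" by standard
  show ?thesis
  proof (rule P.PiM_eqI)
    show "sets (density (PiM I (\<lambda>_. lborel)) (\<lambda>x. \<Prod>i\<in>I. F i (x i))) = sets (PiM I (\<lambda>i. density lborel (F i)))"
      by (simp, intro sets_PiM_cong) auto
    fix A assume "\<And>i. i \<in> I \<Longrightarrow> A i \<in> sets (density lborel (F i))"
    then have A: "\<And>i. i \<in> I \<Longrightarrow> A i \<in> sets borel" by simp
    have ind: "indicator (Pi\<^sub>E I A) x = (\<Prod>i\<in>I. indicator (A i) (x i) :: ennreal)"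
      if "x \<in> space (PiM I (\<lambda>_. lborel))" for x :: "'i \<Rightarrow> real"
      using I that by (auto simp: indicator_def PiE_iff space_PiM intro!: prod.neutral[symmetric])
    have "emeasure (density (PiM I (\<lambda>_. lborel)) (\<lambda>x. \<Prod>i\<in>I. F i (x i))) (Pi\<^sub>E I A)
       = (\<integral>\<^sup>+x. (\<Prod>i\<in>I. F i (x i)) * indicator (Pi\<^sub>E I A) x \<partial>PiM I (\<lambda>_. lborel))"
      using A I by (intro emeasure_density sets_PiM_I_finite) auto
    also have "\<dots> = (\<integral>\<^sup>+x. (\<Prod>i\<in>I. F i (x i) * indicator (A i) (x i)) \<partial>PiM I (\<lambda>_. lborel))"
      by (intro nn_integral_cong) (simp add: ind prod.distrib)
    also have "\<dots> = (\<Prod>i\<in>I. \<integral>\<^sup>+x. F i x * indicator (A i) x \<partial>lborel)"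
      using A by (intro L.product_nn_integral_prod I) auto
    also have "\<dots> = (\<Prod>i\<in>I. emeasure (density lborel (F i)) (A i))"
      using A by (intro prod.cong refl emeasure_density[symmetric]) auto
    finally show "emeasure (density (PiM I (\<lambda>_. lborel)) (\<lambda>x. \<Prod>i\<in>I. F i (x i))) (Pi\<^sub>E I A)
      = (\<Prod>i\<in>I. emeasure (density lborel (F i)) (A i))" .
  qed fact
qed

section \<open>The multivariate normal law\<close>

text \<open>Coefficients are functions of two indices rather than matrices, so that passing to the
  first \<open>p\<close> variables in an induction changes nothing but the bound.\<close>

definition quad_form :: "nat \<Rightarrow> (nat \<Rightarrow> nat \<Rightarrow> real) \<Rightarrow> (nat \<Rightarrow> real) \<Rightarrow> real" where
  "quad_form p b x = (\<Sum>i<p. \<Sum>j<p. b i j * x i * x j)"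

definition pos_form :: "nat \<Rightarrow> (nat \<Rightarrow> nat \<Rightarrow> real) \<Rightarrow> bool" where
  "pos_form p b \<longleftrightarrow> (\<forall>i<p. \<forall>j<p. b i j = b j i) \<and> (\<forall>x. (\<exists>i<p. x i \<noteq> 0) \<longrightarrow> 0 < quad_form p b x)"

abbreviation schur :: "nat \<Rightarrow> (nat \<Rightarrow> nat \<Rightarrow> real) \<Rightarrow> nat \<Rightarrow> nat \<Rightarrow> real" where
  "schur p b i j \<equiv> b i j - b i p * b p j / b p p"

text \<open>The square in the last variable is completed; the remainder is the form of the Schur
  complement in one variable less.\<close>

lemma quad_form_Suc:
  assumes sym: "\<And>i j. i < Suc p \<Longrightarrow> j < Suc p \<Longrightarrow> b i j = b j i" and d: "b p p \<noteq> 0"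
  shows "quad_form (Suc p) b x = quad_form p (schur p b) x + b p p * (x p + (\<Sum>i<p. b i p * x i) / b p p)\<^sup>2"
proof -
  define s where "s = (\<Sum>i<p. b i p * x i)"
  have "quad_form (Suc p) b x = quad_form p b x + (\<Sum>i<p. b i p * x i * x p) + (\<Sum>j<p. b p j * x p * x j) + b p p * x p * x p"
    by (simp add: quad_form_def sum.distrib)
  also have "(\<Sum>i<p. b i p * x i * x p) = s * x p" by (simp add: s_def sum_distrib_right)
  also have "(\<Sum>j<p. b p j * x p * x j) = s * x p"
    unfolding s_def sum_distrib_right using sym by (intro sum.cong) auto
  finally have 1: "quad_form (Suc p) b x = quad_form p b x + 2 * s * x p + b p p * x p * x p" by simp
  have "(\<Sum>i<p. \<Sum>j<p. b i p * b p j / b p p * x i * x j) = (\<Sum>i<p. b i p * x i) * (\<Sum>j<p. b p j * x j) / b p p"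
    by (simp add: sum_product sum_divide_distrib ac_simps)
  also have "(\<Sum>j<p. b p j * x j) = s" unfolding s_def using sym by (intro sum.cong) auto
  finally have 2: "quad_form p (schur p b) x = quad_form p b x - s * s / b p p"
    by (simp add: quad_form_def left_diff_distrib sum_subtractf s_def)
  show ?thesis unfolding 1 2 s_def[symmetric] using d by (simp add: power2_eq_square field_simps)
qed

lemma pos_form_Suc:
  assumes "pos_form (Suc p) b"
  shows "0 < b p p" "pos_form p (schur p b)"
proof -
  have sym: "\<And>i j. i < Suc p \<Longrightarrow> j < Suc p \<Longrightarrow> b i j = b j i" using assms by (auto simp: pos_form_def)
  have pos: "0 < quad_form (Suc p) b x" if "\<exists>i<Suc p. x i \<noteq> 0" for x using assms that by (auto simp: pos_form_def)
  let ?e = "\<lambda>i. if i = p then 1 else 0 :: real"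
  have "quad_form (Suc p) b ?e = b p p"
    by (simp add: quad_form_def if_distrib[of "\<lambda>t. _ * t"] cong: if_cong)
  then show d: "0 < b p p" using pos[of ?e] by auto
  show "pos_form p (schur p b)" unfolding pos_form_def
  proof (intro conjI allI impI)
    fix i j assume "i < p" "j < p"
    then show "schur p b i j = schur p b j i" using sym[of i j] sym[of i p] sym[of j p] by simp
  next
    fix x :: "nat \<Rightarrow> real" assume "\<exists>i<p. x i \<noteq> 0"
    then obtain i where i: "i < p" "x i \<noteq> 0" by blast
    \<comment> \<open>This last coordinate makes the completed square vanish, so the full form at
      \<open>y\<close> is the Schur form at \<open>x\<close>.\<close>
    define y where "y = x(p := - (\<Sum>i<p. b i p * x i) / b p p)"
    have "0 < quad_form (Suc p) b y" using i by (intro pos exI[of _ i]) (auto simp: y_def)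
    moreover have "(\<Sum>i<p. b i p * y i) = (\<Sum>i<p. b i p * x i)" by (intro sum.cong) (auto simp: y_def)
    moreover have "quad_form p (schur p b) y = quad_form p (schur p b) x"
      unfolding quad_form_def by (intro sum.cong refl) (auto simp: y_def)
    ultimately show "0 < quad_form p (schur p b) x"
      using d by (subst (asm) quad_form_Suc[OF sym]) (auto simp: y_def)
  qed
qed

abbreviation form_mat :: "nat \<Rightarrow> (nat \<Rightarrow> nat \<Rightarrow> real) \<Rightarrow> real mat" where
  "form_mat p b \<equiv> mat p p (\<lambda>(i, j). b i j)"

text \<open>Elimination of the last column: the unit upper triangular matrix \<open>E\<close> has
  determinant 1 and turns the matrix into a block triangular one.\<close>

lemma det_schur:
  assumes d: "b p p \<noteq> 0"
  shows "Determinant.det (form_mat (Suc p) b) = b p p * Determinant.det (form_mat p (schur p b))"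
proof -
  define E where "E = form_mat (Suc p) (\<lambda>i j. if i = j then 1 else if j = p then - b i p / b p p else 0)"
  let ?R = "four_block_mat (form_mat p (schur p b)) (0\<^sub>m p 1) (mat 1 p (\<lambda>(i, j). b p j)) (mat 1 1 (\<lambda>_. b p p))"
  have E: "E \<in> carrier_mat (Suc p) (Suc p)" by (simp add: E_def)
  have "Determinant.det E = prod_list (diag_mat E)"
    by (rule det_upper_triangular[OF _ E]) (auto simp: E_def upper_triangular_def)
  also have "\<dots> = 1" unfolding prod_list_diag_prod by (simp add: E_def)
  finally have dE: "Determinant.det E = 1" .
  have "E * form_mat (Suc p) b = ?R"
  proof (rule eq_matI)
    fix i j assume "i < dim_row ?R" "j < dim_col ?R"
    then have i: "i < Suc p" and j: "j < Suc p" by auto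
    have "(E * form_mat (Suc p) b) $$ (i, j) = (\<Sum>k<Suc p. E $$ (i, k) * b k j)"
      using i j E by (simp add: scalar_prod_def lessThan_atLeast0 del: sum.lessThan_Suc sum.op_ivl_Suc)
    also have "\<dots> = (\<Sum>k<p. (if i = k then b k j else 0)) + (if i = p then b p j else - b i p / b p p * b p j)"
      using i by (simp add: E_def if_distrib[of "\<lambda>t. t * _"] cong: if_cong sum.cong_simp)
    also have "\<dots> = ?R $$ (i, j)"
      using i j d by (auto simp: less_Suc_eq)
    finally show "(E * form_mat (Suc p) b) $$ (i, j) = ?R $$ (i, j)" .
  qed (auto simp: E_def)
  then have "Determinant.det E * Determinant.det (form_mat (Suc p) b) = Determinant.det ?R"
    using det_mult[OF E, of "form_mat (Suc p) b"] by simp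
  also have "\<dots> = Determinant.det (form_mat p (schur p b)) * Determinant.det (mat 1 1 (\<lambda>_. b p p))"
    by (rule det_four_block_mat_upper_right_zero) auto
  finally show ?thesis by (simp add: dE det_single)
qed

text \<open>By Fubini the last variable is integrated first; its integral does not depend on the
  shift, and the Schur form remains. Positivity of the determinant is proved along with it, since
  the induction step divides by the determinant under a square root.\<close>

lemma gaussian_integral:
  "pos_form p b \<Longrightarrow> 0 < Determinant.det (form_mat p b) \<and>
    (\<integral>\<^sup>+x. ennreal (exp (- quad_form p b x / 2)) \<partial>(\<Pi>\<^sub>M k\<in>{..<p}. lborel)) =
      ennreal (sqrt ((2 * pi) ^ p / Determinant.det (form_mat p b)))"
proof (induction p arbitrary: b)
  case 0
  have "Determinant.det (form_mat 0 b) = 1" by (rule det_dim_zero) simp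
  then show ?case by (simp add: PiM_empty quad_form_def)
next
  case (Suc p)
  interpret L: product_sigma_finite "\<lambda>_::nat. lborel :: real measure" by standard
  note d = pos_form_Suc(1)[OF Suc.prems]
  note IH = Suc.IH[OF pos_form_Suc(2)[OF Suc.prems]]
  have sym: "\<And>i j. i < Suc p \<Longrightarrow> j < Suc p \<Longrightarrow> b i j = b j i" using Suc.prems by (auto simp: pos_form_def)
  have det: "Determinant.det (form_mat (Suc p) b) = b p p * Determinant.det (form_mat p (schur p b))"
    by (rule det_schur) (use d in simp)
  have qm: "(\<lambda>x. quad_form q c x) \<in> borel_measurable (\<Pi>\<^sub>M k\<in>{..<q}. lborel)" for q c
    unfolding quad_form_def by measurable
  have one: "(\<integral>\<^sup>+y. ennreal (exp (- (b p p * (y + c)\<^sup>2) / 2)) \<partial>lborel) = ennreal (sqrt (2 * pi / b p p))" for c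
  proof -
    have "(\<integral>\<^sup>+y. ennreal (exp (- (b p p * (y + c)\<^sup>2) / 2)) \<partial>lborel) = (\<integral>\<^sup>+y. ennreal (exp (- (sqrt (b p p) * y)\<^sup>2 / 2)) \<partial>lborel)"
      using d by (subst nn_integral_real_affine[where c=1 and t="- c"]) (auto simp: power_mult_distrib)
    also have "\<dots> = ennreal (sqrt (2 * pi) / sqrt (b p p))"
      using d integral_exp_square[of "sqrt (b p p)"] by (subst nn_integral_eq_integral) auto
    finally show ?thesis by (simp add: real_sqrt_divide)
  qed
  have "(\<integral>\<^sup>+x. ennreal (exp (- quad_form (Suc p) b x / 2)) \<partial>(\<Pi>\<^sub>M k\<in>{..<Suc p}. lborel))
     = (\<integral>\<^sup>+x. \<integral>\<^sup>+y. ennreal (exp (- quad_form (Suc p) b (x(p := y)) / 2)) \<partial>lborel \<partial>(\<Pi>\<^sub>M k\<in>{..<p}. lborel))"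
    unfolding lessThan_Suc using qm[of "Suc p" b] by (intro L.product_nn_integral_insert) (auto simp: lessThan_Suc)
  also have "\<dots> = (\<integral>\<^sup>+x. ennreal (exp (- quad_form p (schur p b) x / 2)) * ennreal (sqrt (2 * pi / b p p)) \<partial>(\<Pi>\<^sub>M k\<in>{..<p}. lborel))"
  proof (rule nn_integral_cong)
    fix x :: "nat \<Rightarrow> real"
    define c where "c = (\<Sum>i<p. b i p * x i) / b p p"
    have q: "quad_form (Suc p) b (x(p := y)) = quad_form p (schur p b) x + b p p * (y + c)\<^sup>2" for y
    proof -
      have "(\<Sum>i<p. b i p * (x(p := y)) i) = (\<Sum>i<p. b i p * x i)" by (intro sum.cong) auto
      moreover have "quad_form p (schur p b) (x(p := y)) = quad_form p (schur p b) x"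
        unfolding quad_form_def by (intro sum.cong refl) auto
      ultimately show ?thesis using d by (subst quad_form_Suc[OF sym]) (auto simp: c_def)
    qed
    have e: "ennreal (exp (- quad_form (Suc p) b (x(p := y)) / 2))
       = ennreal (exp (- quad_form p (schur p b) x / 2)) * ennreal (exp (- (b p p * (y + c)\<^sup>2) / 2))" for y
      unfolding q by (simp add: ennreal_mult[symmetric] exp_add[symmetric] add_divide_distrib diff_divide_distrib)
    show "(\<integral>\<^sup>+y. ennreal (exp (- quad_form (Suc p) b (x(p := y)) / 2)) \<partial>lborel)
      = ennreal (exp (- quad_form p (schur p b) x / 2)) * ennreal (sqrt (2 * pi / b p p))"
      unfolding e one[of c, symmetric] by (rule nn_integral_cmult) measurable
  qed
  also have "\<dots> = ennreal (sqrt ((2 * pi) ^ p / Determinant.det (form_mat p (schur p b)))) * ennreal (sqrt (2 * pi / b p p))"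
    using qm[of p "schur p b"] IH by (subst nn_integral_multc) auto
  also have "\<dots> = ennreal (sqrt ((2 * pi) ^ Suc p / Determinant.det (form_mat (Suc p) b)))"
    unfolding det using d IH
    by (simp add: ennreal_mult[symmetric] real_sqrt_mult[symmetric] ac_simps)
  finally show ?case using det d IH by simp
qed

section \<open>Positive definite matrices and their inverses\<close>

lemma scalar_prod_form:
  assumes "B \<in> carrier_mat p p"
  shows "scalar_prod (Matrix.vec p x) (B *\<^sub>v Matrix.vec p x) = quad_form p (\<lambda>i j. B $$ (i, j)) x"
  using assms by (auto simp: scalar_prod_def quad_form_def sum_distrib_left lessThan_atLeast0 ac_simps intro!: sum.cong)

text \<open>Positivity excludes a kernel. The transpose of \<open>B\<close> is a left inverse of the
  symmetric \<open>A\<close>, hence equals \<open>B\<close>, and the form of \<open>B\<close> at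
  \<open>v\<close> is the form of \<open>A\<close> at \<open>B *\<^sub>v v\<close>.\<close>

lemma pos_def_mat_inverse:
  assumes A: "A \<in> carrier_mat p p" "transpose_mat A = A" "pos_def_mat p A"
  obtains B where "mat_inverse A = Some B" "B \<in> carrier_mat p p" "A * B = 1\<^sub>m p" "B * A = 1\<^sub>m p"
    "transpose_mat B = B" "pos_def_mat p B"
proof -
  have "Determinant.det A \<noteq> 0"
  proof
    assume "Determinant.det A = 0"
    then obtain v where "v \<in> carrier_vec p" "v \<noteq> 0\<^sub>v p" "A *\<^sub>v v = 0\<^sub>v p"
      using det_0_iff_vec_prod_zero[OF A(1)] by blast
    then show False using A(3) by (force simp: pos_def_mat_def)
  qed
  then have "A \<in> Units (ring_mat TYPE(real) p ())"
    by (rule det_non_zero_imp_unit[OF A(1)])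
  then obtain B where B: "mat_inverse A = Some B"
    using mat_inverse(1)[OF A(1), where b="()"] by (cases "mat_inverse A") auto
  from mat_inverse(2)[OF A(1) this] have B': "A * B = 1\<^sub>m p" "B * A = 1\<^sub>m p" "B \<in> carrier_mat p p" by auto
  have tB: "transpose_mat B \<in> carrier_mat p p" using B' by simp
  have "transpose_mat B * A = transpose_mat (A * B)"
    unfolding transpose_mult[OF A(1) B'(3)] A(2) ..
  also have "\<dots> = 1\<^sub>m p" by (simp add: B')
  finally have "transpose_mat B * A * B = B" using B' by simp
  then have "transpose_mat B * (A * B) = B" using assoc_mult_mat[OF tB A(1) B'(3)] by simp
  then have sym: "transpose_mat B = B" using B' tB by simp
  have "pos_def_mat p B" unfolding pos_def_mat_def
  proof (intro ballI impI)
    fix v :: "real Matrix.vec" assume v: "v \<in> carrier_vec p" "v \<noteq> 0\<^sub>v p"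
    define w where "w = B *\<^sub>v v"
    have w: "w \<in> carrier_vec p" using B' v by (simp add: w_def)
    have "A *\<^sub>v w = (A * B) *\<^sub>v v" unfolding w_def by (rule assoc_mult_mat_vec[OF A(1) B'(3) v(1), symmetric])
    then have Aw: "A *\<^sub>v w = v" using B' v by simp
    then have "w \<noteq> 0\<^sub>v p" using v A by auto
    then have "0 < scalar_prod w (A *\<^sub>v w)" using A(3) w by (auto simp: pos_def_mat_def)
    then show "0 < scalar_prod v (B *\<^sub>v v)"
      unfolding Aw w_def[symmetric] using comm_scalar_prod[OF v(1) w] by simp
  qed
  with B B' sym show ?thesis by (intro that[of B]) auto
qed

lemma pos_form_of_mat:
  assumes "B \<in> carrier_mat p p" "transpose_mat B = B" "pos_def_mat p B"
  shows "pos_form p (\<lambda>i j. B $$ (i, j))"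
  unfolding pos_form_def
proof (intro conjI allI impI)
  fix i j assume "i < p" "j < p"
  then have "B $$ (i, j) = transpose_mat B $$ (j, i)" using assms(1) by simp
  then show "B $$ (i, j) = B $$ (j, i)" using assms(2) by simp
next
  fix x :: "nat \<Rightarrow> real" assume "\<exists>i<p. x i \<noteq> 0"
  then have "Matrix.vec p x \<noteq> 0\<^sub>v p" by (metis index_vec index_zero_vec(1))
  then show "0 < quad_form p (\<lambda>i j. B $$ (i, j)) x"
    using assms(3) by (simp add: scalar_prod_form[OF assms(1), symmetric] pos_def_mat_def)
qed

lemma sets_mvn: "sets (mvn p A) = sets (vec_borel p)"
  unfolding mvn_def vec_borel_def by (simp, intro sets_PiM_cong) auto

lemma prob_space_mvn:
  assumes A: "A \<in> carrier_mat p p" "transpose_mat A = A" "pos_def_mat p A"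
  shows "prob_space (mvn p A)"
proof -
  obtain B where B: "mat_inverse A = Some B" "B \<in> carrier_mat p p" "A * B = 1\<^sub>m p" "B * A = 1\<^sub>m p"
    "transpose_mat B = B" "pos_def_mat p B" using pos_def_mat_inverse[OF A] .
  let ?b = "\<lambda>i j. B $$ (i, j)"
  have fm: "form_mat p ?b = B" using B(2) by (intro eq_matI) auto
  from gaussian_integral[OF pos_form_of_mat[OF B(2,5,6)]]
  have g: "0 < Determinant.det B"
    "(\<integral>\<^sup>+x. ennreal (exp (- quad_form p ?b x / 2)) \<partial>(\<Pi>\<^sub>M k\<in>{..<p}. lborel)) = ennreal (sqrt ((2 * pi) ^ p / Determinant.det B))"
    unfolding fm by auto
  have dd: "Determinant.det A * Determinant.det B = 1" using det_mult[OF A(1) B(2)] B(3) by simp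
  then have dA: "Determinant.det A = 1 / Determinant.det B" using g(1) by (simp add: field_simps)
  have [measurable]: "(\<lambda>x. quad_form p ?b x) \<in> borel_measurable (\<Pi>\<^sub>M k\<in>{..<p}. lborel)"
    unfolding quad_form_def by measurable
  define c where "c = 1 / sqrt ((2 * pi) ^ p * Determinant.det A)"
  have c0: "0 \<le> c" using g(1) by (simp add: c_def dA)
  have mvn: "mvn p A = density (\<Pi>\<^sub>M k\<in>{..<p}. lborel) (\<lambda>x. ennreal c * ennreal (exp (- quad_form p ?b x / 2)))"
    unfolding mvn_def B(1) option.sel scalar_prod_form[OF B(2)] using c0
    by (simp add: c_def ennreal_mult'[symmetric])
  have "emeasure (mvn p A) (space (mvn p A)) = (\<integral>\<^sup>+x. ennreal c * ennreal (exp (- quad_form p ?b x / 2)) \<partial>(\<Pi>\<^sub>M k\<in>{..<p}. lborel))"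
    unfolding mvn by (subst emeasure_density) (auto intro!: nn_integral_cong simp: indicator_def)
  also have "\<dots> = ennreal c * ennreal (sqrt ((2 * pi) ^ p / Determinant.det B))"
    unfolding g(2)[symmetric] by (rule nn_integral_cmult) measurable
  also have "\<dots> = ennreal (c * sqrt ((2 * pi) ^ p / Determinant.det B))"
    using c0 by (simp add: ennreal_mult')
  also have "c * sqrt ((2 * pi) ^ p / Determinant.det B) = 1"
    using g(1) by (simp add: c_def dA)
  finally show ?thesis by (intro prob_spaceI) simp
qed

section \<open>The observation law of an arbitrary model\<close>

lemma measurable_add_sample:
  "(\<lambda>(x, e). \<lambda>j\<in>{..<n}. \<lambda>k\<in>{..<p}. x j k + e j k) \<in>
     measurable ((\<Pi>\<^sub>M j\<in>{..<n}. vec_borel p) \<Otimes>\<^sub>M (\<Pi>\<^sub>M j\<in>{..<n}. vec_borel p)) (sample_borel n p)"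
  unfolding sample_borel_def vec_borel_def split_beta
proof (intro measurable_restrict borel_measurable_add)
  fix j k assume "j \<in> {..<n}" "k \<in> {..<p}"
  then have *: "(\<lambda>x. x j k) \<in> borel_measurable (\<Pi>\<^sub>M j\<in>{..<n}. \<Pi>\<^sub>M k\<in>{..<p}. (borel :: real measure))"
    by (intro measurable_compose[of "\<lambda>x. x j" _ "\<Pi>\<^sub>M k\<in>{..<p}. borel" "\<lambda>v. v k"] measurable_component_singleton)
  let ?M = "(\<Pi>\<^sub>M j\<in>{..<n}. \<Pi>\<^sub>M k\<in>{..<p}. (borel :: real measure)) \<Otimes>\<^sub>M (\<Pi>\<^sub>M j\<in>{..<n}. \<Pi>\<^sub>M k\<in>{..<p}. (borel :: real measure))"
  show "(\<lambda>z. fst z j k) \<in> borel_measurable ?M" by (rule measurable_compose[where f=fst and g="\<lambda>x. x j k", OF measurable_fst *])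
  show "(\<lambda>z. snd z j k) \<in> borel_measurable ?M" by (rule measurable_compose[where f=snd and g="\<lambda>x. x j k", OF measurable_snd *])
qed

text \<open>Gives the upper bound 1 for the probabilities in the supremum over all models, diagonal
  or not.\<close>

lemma prob_space_obs_law:
  assumes "(A, \<psi>, \<nu>) \<in> models p \<beta> S R T"
  shows "prob_space (obs_law n p A \<nu>)"
proof -
  have A: "prob_space (mvn p A)" using assms by (auto simp: models_def cov_class_def intro: prob_space_mvn)
  have nu: "prob_space \<nu>" "sets \<nu> = sets (vec_borel p)" using assms by (auto simp: models_def law_with_char_def)
  interpret M: prob_space "\<Pi>\<^sub>M j\<in>{..<n}. mvn p A" by (rule prob_space_PiM) (rule A)
  interpret N: prob_space "\<Pi>\<^sub>M j\<in>{..<n}. \<nu>" by (rule prob_space_PiM) (rule nu)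
  interpret P: pair_prob_space "\<Pi>\<^sub>M j\<in>{..<n}. mvn p A" "\<Pi>\<^sub>M j\<in>{..<n}. \<nu>" ..
  have s: "sets ((\<Pi>\<^sub>M j\<in>{..<n}. mvn p A) \<Otimes>\<^sub>M (\<Pi>\<^sub>M j\<in>{..<n}. \<nu>)) =
     sets ((\<Pi>\<^sub>M j\<in>{..<n}. vec_borel p) \<Otimes>\<^sub>M (\<Pi>\<^sub>M j\<in>{..<n}. vec_borel p))"
    by (intro sets_pair_measure_cong sets_PiM_cong) (auto simp: sets_mvn nu)
  show ?thesis unfolding obs_law_def
    by (rule P.prob_space_distr) (use measurable_add_sample in \<open>simp add: measurable_cong_sets[OF s refl]\<close>)
qed

section \<open>Diagonal models\<close>

definition diagonal :: "nat \<Rightarrow> (nat \<Rightarrow> real) \<Rightarrow> real mat" where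
  "diagonal p d = mat p p (\<lambda>(i, j). if i = j then d i else 0)"

lemma diagonal_carrier [simp]: "diagonal p d \<in> carrier_mat p p"
  by (simp add: diagonal_def)

lemma diagonal_mult_vec: "diagonal p d *\<^sub>v Matrix.vec p x = Matrix.vec p (\<lambda>i. d i * x i)"
  by (intro eq_vecI) (auto simp: diagonal_def scalar_prod_def if_distrib[of "\<lambda>t. t * _"] cong: if_cong)

lemma pos_def_mat_diagonal:
  assumes "\<And>k. 0 < d k"
  shows "pos_def_mat p (diagonal p d)"
  unfolding pos_def_mat_def
proof (intro ballI impI)
  fix v :: "real Matrix.vec" assume v: "v \<in> carrier_vec p" "v \<noteq> 0\<^sub>v p"
  then have v': "v = Matrix.vec p (\<lambda>i. v $ i)" by auto
  obtain i where i: "i < p" "v $ i \<noteq> 0" using v by (metis carrier_vecD eq_vecI index_zero_vec)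
  have "scalar_prod v (diagonal p d *\<^sub>v v) = (\<Sum>k<p. d k * (v $ k)\<^sup>2)"
    by (subst (2) v', subst diagonal_mult_vec) (simp add: scalar_prod_def lessThan_atLeast0 power2_eq_square ac_simps)
  also have "\<dots> > 0"
  proof (rule sum_pos2[of _ i])
    show "0 < d i * (v $ i)\<^sup>2" using i assms[of i] by simp
    show "0 \<le> d k * (v $ k)\<^sup>2" for k using assms[of k] by simp
  qed (use i in auto)
  finally show "0 < scalar_prod v (diagonal p d *\<^sub>v v)" .
qed

lemma diagonal_in_cov_class:
  assumes "\<And>k. 0 < d k" "\<And>k. d k \<le> R" "real p \<le> S" "1 \<le> p"
  shows "diagonal p d \<in> cov_class p S R"
proof -
  have "transpose_mat (diagonal p d) = diagonal p d" by (intro eq_matI) (auto simp: diagonal_def)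
  moreover have "num_nonzero (diagonal p d) \<le> p"
  proof -
    have "{(i, j). i < dim_row (diagonal p d) \<and> j < dim_col (diagonal p d) \<and> diagonal p d $$ (i, j) \<noteq> 0}
       \<subseteq> (\<lambda>i. (i, i)) ` {..<p}" by (auto simp: diagonal_def split: if_splits)
    then have "num_nonzero (diagonal p d) \<le> card ((\<lambda>i. (i, i)) ` {..<p})"
      unfolding num_nonzero_def by (intro card_mono) auto
    also have "\<dots> \<le> p" using card_image_le[of "{..<p}" "\<lambda>i. (i, i)"] by simp
    finally show ?thesis .
  qed
  moreover have "max_entry (diagonal p d) \<le> R"
  proof -
    have R: "0 \<le> R" using assms(1,2)[of 0] by linarith
    \<comment> \<open>\<open>Max\<close> is meaningful only on a nonempty set; this is where
      \<open>1 \<le> p\<close> enters.\<close>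
    have "diagonal p d $$ (0, 0) \<in> elements_mat (diagonal p d)"
      using assms(4) by (intro elements_matI[of _ p p]) auto
    then have ne: "elements_mat (diagonal p d) \<noteq> {}" by auto
    show ?thesis unfolding max_entry_def
    proof (subst Max_le_iff)
      show "finite ((\<lambda>x. \<bar>x\<bar>) ` elements_mat (diagonal p d))" by (simp add: elements_mat_def)
      show "\<forall>a\<in>(\<lambda>x. \<bar>x\<bar>) ` elements_mat (diagonal p d). a \<le> R"
        using R assms(1,2) by (auto dest!: elements_matD simp: diagonal_def less_imp_le)
    qed (use ne in auto)
  qed
  ultimately show ?thesis using assms pos_def_mat_diagonal[OF assms(1)] by (auto simp: cov_class_def)
qed

text \<open>The inverse matrix occurs only through its action on vectors, which is found by applying
  \<open>B\<close> to the image under the diagonal matrix of \<open>x\<close> divided by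
  \<open>d\<close>. The density then factorises.\<close>

lemma mvn_diagonal:
  assumes d: "\<And>k. 0 < d k"
  shows "mvn p (diagonal p d) = (\<Pi>\<^sub>M k\<in>{..<p}. gauss (sqrt (d k)))"
proof -
  let ?D = "diagonal p d"
  have sym: "transpose_mat ?D = ?D" by (intro eq_matI) (auto simp: diagonal_def)
  obtain B where B: "mat_inverse ?D = Some B" "B \<in> carrier_mat p p" "?D * B = 1\<^sub>m p" "B * ?D = 1\<^sub>m p"
    using pos_def_mat_inverse[OF diagonal_carrier sym pos_def_mat_diagonal[OF d]] by metis
  have Bx: "B *\<^sub>v Matrix.vec p x = Matrix.vec p (\<lambda>i. x i / d i)" for x
  proof -
    have "?D *\<^sub>v Matrix.vec p (\<lambda>i. x i / d i) = Matrix.vec p x"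
      unfolding diagonal_mult_vec using d by (intro eq_vecI) (auto simp: less_imp_neq[symmetric])
    then have "B *\<^sub>v Matrix.vec p x = B *\<^sub>v (?D *\<^sub>v Matrix.vec p (\<lambda>i. x i / d i))" by simp
    also have "\<dots> = (B * ?D) *\<^sub>v Matrix.vec p (\<lambda>i. x i / d i)"
      using B by (intro assoc_mult_mat_vec[symmetric]) auto
    finally show ?thesis using B by simp
  qed
  have q: "scalar_prod (Matrix.vec p x) (B *\<^sub>v Matrix.vec p x) = (\<Sum>k<p. (x k)\<^sup>2 / d k)" for x
    unfolding Bx by (simp add: scalar_prod_def lessThan_atLeast0 power2_eq_square)
  have "Determinant.det ?D = prod_list (diag_mat ?D)"
    by (rule det_upper_triangular[of _ p]) (auto simp: diagonal_def)
  also have "\<dots> = (\<Prod>k<p. d k)" unfolding prod_list_diag_prod by (simp add: diagonal_def lessThan_atLeast0)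
  finally have det: "Determinant.det ?D = (\<Prod>k<p. d k)" .
  have "exp (- (\<Sum>k<p. (x k)\<^sup>2 / d k) / 2) / sqrt ((2 * pi) ^ p * (\<Prod>k<p. d k))
     = (\<Prod>k<p. normal_density 0 (sqrt (d k)) (x k))" for x
  proof -
    have "(\<Prod>k<p. normal_density 0 (sqrt (d k)) (x k)) = (\<Prod>k<p. exp (- (x k)\<^sup>2 / d k / 2) / sqrt (2 * pi * d k))"
      using d by (intro prod.cong refl) (simp add: normal_density_def less_imp_le mult.commute)
    also have "\<dots> = exp (\<Sum>k<p. - (x k)\<^sup>2 / d k / 2) / (\<Prod>k<p. sqrt (2 * pi * d k))"
      by (simp add: prod_dividef exp_sum)
    also have "(\<Prod>k<p. sqrt (2 * pi * d k)) = sqrt (\<Prod>k<p. 2 * pi * d k)"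
      by (induction p) (simp_all add: real_sqrt_mult)
    also have "(\<Prod>k<p. 2 * pi * d k) = (2 * pi) ^ p * (\<Prod>k<p. d k)" by (simp add: prod.distrib power_mult_distrib)
    also have "(\<Sum>k<p. - (x k)\<^sup>2 / d k / 2) = - (\<Sum>k<p. (x k)\<^sup>2 / d k) / 2"
      by (simp add: sum_negf sum_divide_distrib)
    finally show ?thesis by simp
  qed
  then have "mvn p ?D = density (\<Pi>\<^sub>M k\<in>{..<p}. lborel) (\<lambda>x. \<Prod>k<p. ennreal (normal_density 0 (sqrt (d k)) (x k)))"
    unfolding mvn_def B(1) option.sel q det by (simp add: prod_ennreal)
  also have "\<dots> = (\<Pi>\<^sub>M k\<in>{..<p}. gauss (sqrt (d k)))"
    using d by (intro density_PiM_lborel prob_space_normal_density) auto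
  finally show ?thesis .
qed

lemma obs_law_diagonal:
  assumes d: "\<And>k. 0 < d k" and nu: "\<And>k. real_distribution (\<nu> k)"
  shows "obs_law n p (diagonal p d) (\<Pi>\<^sub>M k\<in>{..<p}. \<nu> k) =
    (\<Pi>\<^sub>M j\<in>{..<n}. \<Pi>\<^sub>M k\<in>{..<p}. gauss (sqrt (d k)) \<star> \<nu> k)"
proof -
  have G: "prob_space (gauss (sqrt (d k)))" for k using d by (intro prob_space_normal_density) simp
  have N: "prob_space (\<nu> k)" and [measurable_cong]: "sets (\<nu> k) = sets borel" for k
    using nu by (auto simp: real_distribution_def real_distribution_axioms_def)
  let ?G = "\<Pi>\<^sub>M k\<in>{..<p}. gauss (sqrt (d k))" and ?N = "\<Pi>\<^sub>M k\<in>{..<p}. \<nu> k"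
  let ?f = "\<lambda>(x, e). \<lambda>k\<in>{..<p}. (case (x k, e k) of (a :: real, b) \<Rightarrow> a + b)"
  have PG: "prob_space ?G" "prob_space ?N" by (auto intro!: prob_space_PiM G N)
  have inner: "distr (?G \<Otimes>\<^sub>M ?N) (vec_borel p) ?f = (\<Pi>\<^sub>M k\<in>{..<p}. gauss (sqrt (d k)) \<star> \<nu> k)"
    unfolding vec_borel_def convolution_def
    by (rule distr_pair_PiM) (auto simp: G N)
  have fm: "?f \<in> measurable (?G \<Otimes>\<^sub>M ?N) (vec_borel p)"
    unfolding vec_borel_def split_beta by (intro measurable_restrict) measurable
  have "obs_law n p (diagonal p d) ?N =
    distr ((\<Pi>\<^sub>M j\<in>{..<n}. ?G) \<Otimes>\<^sub>M (\<Pi>\<^sub>M j\<in>{..<n}. ?N)) (\<Pi>\<^sub>M j\<in>{..<n}. vec_borel p) (\<lambda>(x, e). \<lambda>j\<in>{..<n}. ?f (x j, e j))"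
    unfolding obs_law_def mvn_diagonal[OF d] sample_borel_def by simp
  also have "\<dots> = (\<Pi>\<^sub>M j\<in>{..<n}. distr (?G \<Otimes>\<^sub>M ?N) (vec_borel p) ?f)"
    by (rule distr_pair_PiM[OF finite_lessThan PG fm])
  finally show ?thesis unfolding inner .
qed

lemma char_vec_PiM:
  assumes nu: "\<And>k. real_distribution (\<nu> k)"
  shows "char_vec p (\<Pi>\<^sub>M k\<in>{..<p}. \<nu> k) u = (\<Prod>k<p. char (\<nu> k) (u k))"
proof -
  have N: "prob_space (\<nu> k)" and [measurable_cong]: "sets (\<nu> k) = sets borel" for k
    using nu by (auto simp: real_distribution_def real_distribution_axioms_def)
  interpret N: product_prob_space \<nu> by (rule product_prob_spaceI) (rule N)
  have "char_vec p (\<Pi>\<^sub>M k\<in>{..<p}. \<nu> k) u = (CLINT x|(\<Pi>\<^sub>M k\<in>{..<p}. \<nu> k). \<Prod>k<p. iexp (u k * x k))"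
    unfolding char_vec_def by (simp add: exp_sum sum_distrib_left)
  also have "\<dots> = (\<Prod>k<p. char (\<nu> k) (u k))"
    unfolding char_def
    by (intro N.product_integral_prod finite_lessThan prob_space.integrable_iexp N) auto
  finally show ?thesis .
qed

section \<open>Assouad's argument\<close>

lemma sum_Pow_split:
  fixes f :: "nat set \<Rightarrow> real"
  assumes "k < p"
  shows "sum f (Pow {..<p}) = (\<Sum>\<omega>\<in>Pow ({..<p} - {k}). f \<omega> + f (insert k \<omega>))"
proof -
  let ?J = "{..<p} - {k}"
  have "{..<p} = insert k ?J" using assms by auto
  then have "Pow {..<p} = Pow ?J \<union> insert k ` Pow ?J" by (metis Pow_insert)
  then have "sum f (Pow {..<p}) = sum f (Pow ?J) + sum f (insert k ` Pow ?J)"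
    by (simp only:) (intro sum.union_disjoint, auto)
  also have "sum f (insert k ` Pow ?J) = (\<Sum>\<omega>\<in>Pow ?J. f (insert k \<omega>))"
    by (subst sum.reindex) (auto simp: inj_on_def)
  finally show ?thesis by (simp add: sum.distrib)
qed

text \<open>\<open>E k\<close> is the event that a test decides against
  \<open>k \<in> \<omega>\<close>. Averaging over the edges of the hypercube yields a vertex with at
  least \<open>p / 4\<close> expected errors; since there are at most \<open>p\<close> errors, a
  reverse Markov inequality turns the expectation into a probability.\<close>

lemma assouad:
  assumes p: "1 \<le> p" and P: "\<And>\<omega>. prob_space (P \<omega>)" "\<And>\<omega>. sets (P \<omega>) = sets S"
    and E: "\<And>k. k < p \<Longrightarrow> E k \<in> sets S"
    and sep: "\<And>k \<omega>. k < p \<Longrightarrow> \<omega> \<subseteq> {..<p} \<Longrightarrow> k \<notin> \<omega> \<Longrightarrow>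
      1 / 2 \<le> measure (P \<omega>) (space S - E k) + measure (P (insert k \<omega>)) (E k)"
  shows "\<exists>\<omega>\<subseteq>{..<p}. 1 / 8 \<le> measure (P \<omega>)
    {y \<in> space S. real p / 8 \<le> (\<Sum>k<p. of_bool ((k \<in> \<omega>) = (y \<in> E k)))}"
proof -
  \<comment> \<open>The event that the decision on coordinate \<open>k\<close> is wrong under
    \<omega>.\<close>
  define F where "F k \<omega> = (if k \<in> \<omega> then E k else space S - E k)" for k \<omega>
  have F: "F k \<omega> \<in> sets S" if "k < p" for k \<omega> using E[OF that] by (simp add: F_def)
  define a where "a \<omega> = (\<Sum>k<p. measure (P \<omega>) (F k \<omega>))" for \<omega>
  \<comment> \<open>Each direction has \<open>2 ^ (p - 1)\<close> edges, and each edge contributes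
    at least 1/2.\<close>
  have "real (2 ^ p) * (real p / 4) \<le> (\<Sum>\<omega>\<in>Pow {..<p}. a \<omega>)"
  proof -
    have "real (2 ^ p) / 4 \<le> (\<Sum>\<omega>\<in>Pow {..<p}. measure (P \<omega>) (F k \<omega>))" if k: "k < p" for k
    proof -
      have "real (2 ^ p) / 4 = (\<Sum>\<omega>\<in>Pow ({..<p} - {k}). 1 / 2 :: real)"
        using k p by (simp add: card_Pow power_eq_if)
      also have "\<dots> \<le> (\<Sum>\<omega>\<in>Pow ({..<p} - {k}). measure (P \<omega>) (F k \<omega>) + measure (P (insert k \<omega>)) (F k (insert k \<omega>)))"
      proof (rule sum_mono)
        fix \<omega> assume "\<omega> \<in> Pow ({..<p} - {k})"
        then show "1 / 2 \<le> measure (P \<omega>) (F k \<omega>) + measure (P (insert k \<omega>)) (F k (insert k \<omega>))"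
          using sep[OF k, of \<omega>] by (auto simp: F_def)
      qed
      also have "\<dots> = (\<Sum>\<omega>\<in>Pow {..<p}. measure (P \<omega>) (F k \<omega>))"
        by (rule sum_Pow_split[OF k, symmetric])
      finally show ?thesis .
    qed
    then have "(\<Sum>k<p. real (2 ^ p) / 4) \<le> (\<Sum>k<p. \<Sum>\<omega>\<in>Pow {..<p}. measure (P \<omega>) (F k \<omega>))"
      by (intro sum_mono) auto
    also have "\<dots> = (\<Sum>\<omega>\<in>Pow {..<p}. a \<omega>)" unfolding a_def by (rule sum.swap)
    finally show ?thesis by (simp add: mult.commute)
  qed
  have "\<exists>\<omega>\<in>Pow {..<p}. real p / 4 \<le> a \<omega>"
  proof (rule ccontr)
    assume "\<not> ?thesis"
    then have "(\<Sum>\<omega>\<in>Pow {..<p}. a \<omega>) < (\<Sum>\<omega>\<in>Pow {..<p}. real p / 4)"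
      by (intro sum_strict_mono) (auto simp: not_le)
    also have "\<dots> = real (2 ^ p) * (real p / 4)" by (simp add: card_Pow)
    finally show False using \<open>real (2 ^ p) * (real p / 4) \<le> _\<close> by simp
  qed
  then obtain \<omega> where \<omega>: "\<omega> \<subseteq> {..<p}" "real p / 4 \<le> a \<omega>" by auto
  interpret prob_space "P \<omega>" by (rule P)
  have sp: "space (P \<omega>) = space S" using P(2) by (rule sets_eq_imp_space_eq)
  define N where "N y = (\<Sum>k<p. of_bool ((k \<in> \<omega>) = (y \<in> E k)) :: real)" for y
  have NF: "N y = (\<Sum>k<p. indicator (F k \<omega>) y)" if "y \<in> space S" for y
    unfolding N_def F_def using that by (intro sum.cong) (auto simp: indicator_def)
  let ?G = "{y \<in> space S. real p / 8 \<le> N y}"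
  have "?G = {y \<in> space S. real p / 8 \<le> (\<Sum>k<p. indicator (F k \<omega>) y)}" using NF by auto
  also have "\<dots> \<in> sets S"
    using F by (intro borel_measurable_le[unfolded pred_def] borel_measurable_const borel_measurable_sum borel_measurable_indicator) auto
  finally have G: "?G \<in> sets (P \<omega>)" using P(2) by simp
  have F': "F k \<omega> \<in> sets (P \<omega>)" if "k < p" for k using F[OF that] P(2) by simp
  have "a \<omega> = (\<integral>y. (\<Sum>k<p. indicator (F k \<omega>) y) \<partial>P \<omega>)"
    unfolding a_def using F' by (subst Bochner_Integration.integral_sum) (auto simp: emeasure_eq_measure)
  \<comment> \<open>At most \<open>p\<close> errors on \<open>?G\<close>, fewer than
    \<open>p / 8\<close> off it.\<close>
  also have "\<dots> \<le> (\<integral>y. real p * indicator ?G y + real p / 8 \<partial>P \<omega>)"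
  proof (rule integral_mono)
    fix y assume "y \<in> space (P \<omega>)"
    then have y: "y \<in> space S" by (simp add: sp)
    have "N y \<le> (\<Sum>k<p. 1)" unfolding N_def by (intro sum_mono) auto
    then have "N y \<le> real p" by simp
    then show "(\<Sum>k<p. indicator (F k \<omega>) y) \<le> real p * indicator ?G y + real p / 8"
      using y unfolding NF[OF y, symmetric] by (auto simp: indicator_def)
  qed (use F' G in \<open>auto simp: emeasure_eq_measure\<close>)
  also have "\<dots> = real p * measure (P \<omega>) ?G + real p / 8"
    using G by (subst Bochner_Integration.integral_add) (auto simp: emeasure_eq_measure prob_space)
  finally have "real p * (1 / 8) \<le> real p * measure (P \<omega>) ?G" using \<omega>(2) by simp
  then have "1 / 8 \<le> measure (P \<omega>) ?G" using p by (subst (asm) mult_le_cancel_left_pos) auto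
  with \<omega>(1) show ?thesis unfolding N_def by blast
qed

section \<open>The Frobenius norm\<close>

lemma frobenius_norm_eq:
  assumes "D \<in> carrier_mat p p"
  shows "frobenius_norm D = sqrt (\<Sum>i<p. \<Sum>j<p. (D $$ (j, i))\<^sup>2)"
proof -
  have "sum_list (diag_mat (transpose_mat D * D)) = (\<Sum>i<p. (transpose_mat D * D) $$ (i, i))"
    using assms by (simp add: diag_mat_def interv_sum_list_conv_sum_set_nat lessThan_atLeast0)
  also have "\<dots> = (\<Sum>i<p. \<Sum>j<p. (D $$ (j, i))\<^sup>2)"
    using assms by (intro sum.cong refl) (auto simp: scalar_prod_def lessThan_atLeast0 power2_eq_square)
  finally show ?thesis by (simp add: frobenius_norm_def)
qed

lemma estimator_error:
  assumes est: "est \<in> estimators n p" and A: "A \<in> carrier_mat p p" and y: "y \<in> space (sample_borel n p)"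
  shows "frobenius_norm (est y - A) = sqrt (\<Sum>i<p. \<Sum>j<p. (est y $$ (j, i) - A $$ (j, i))\<^sup>2)"
proof -
  have "est y \<in> carrier_mat p p" using est y by (auto simp: estimators_def)
  then have "est y - A \<in> carrier_mat p p" using A by auto
  then show ?thesis using A \<open>est y \<in> carrier_mat p p\<close>
    unfolding frobenius_norm_eq[OF \<open>est y - A \<in> carrier_mat p p\<close>] by (auto intro!: arg_cong[of _ _ sqrt] sum.cong)
qed

text \<open>\<open>measure\<close> is 0 outside the sigma-algebra, so monotonicity of the
  probabilities depends on this.\<close>

lemma sets_estimator_error:
  assumes est: "est \<in> estimators n p" and A: "A \<in> carrier_mat p p"
  shows "{y \<in> space (sample_borel n p). c \<le> frobenius_norm (est y - A)} \<in> sets (sample_borel n p)"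
proof -
  have [measurable]: "(\<lambda>y. est y $$ (j, i)) \<in> borel_measurable (sample_borel n p)" if "i < p" "j < p" for i j
    using est that by (auto simp: estimators_def)
  have "(\<lambda>y. sqrt (\<Sum>i<p. \<Sum>j<p. (est y $$ (j, i) - A $$ (j, i))\<^sup>2)) \<in> borel_measurable (sample_borel n p)"
    by measurable
  then have "{y \<in> space (sample_borel n p). c \<le> sqrt (\<Sum>i<p. \<Sum>j<p. (est y $$ (j, i) - A $$ (j, i))\<^sup>2)} \<in> sets (sample_borel n p)"
    by measurable
  also have "{y \<in> space (sample_borel n p). c \<le> sqrt (\<Sum>i<p. \<Sum>j<p. (est y $$ (j, i) - A $$ (j, i))\<^sup>2)}
    = {y \<in> space (sample_borel n p). c \<le> frobenius_norm (est y - A)}"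
    using estimator_error[OF est A] by auto
  finally show ?thesis .
qed

section \<open>The two hypotheses in one coordinate\<close>

definition noise_const :: real where "noise_const = jump_const / (12 * cos_kappa)"

lemma noise_const_pos: "0 < noise_const"
  using jump_const_pos cos_kappa_pos by (simp add: noise_const_def)

text \<open>The variance \<open>R\<close> with noise \<open>False\<close> is matched with
  \<open>R - \<delta>\<close> and noise \<open>True\<close>, whose exponent is larger by exactly the
  missing Gaussian part. Both variances are at least \<open>R / 2\<close>, and each of the two error
  terms is brought below \<open>1 / (4 * n)\<close>.\<close>

lemma tv_close_coordinate:
  fixes n q :: nat
  assumes R: "0 < R" "0 < \<delta>" "\<delta> \<le> R / 2" and n: "2 \<le> n"
    and m: "m = sqrt (2 * (1 + noise_const))" and q: "8 * m \<le> 2 ^ q"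
    and U: "0 < U" "R * U\<^sup>2 = 8 * (2 + real q) * ln (real n)"
    and nu: "\<And>b. real_distribution (\<nu> b)" "\<And>b u. char (\<nu> b) u = of_real (exp (- noise_exponent b \<delta> U u))"
  shows "tv_close (gauss (sqrt R) \<star> \<nu> False) (gauss (sqrt (R - \<delta>)) \<star> \<nu> True) (ennreal (1 / (2 * real n)))"
proof -
  \<comment> \<open>\<open>B\<close> collects \<open>R / 2\<close> from the Gaussian and at most
    \<open>noise_const * R / 2\<close> from the noise; \<open>M\<close> is then chosen so that
    \<open>B / M\<^sup>2\<close> is exactly \<open>1 / (4 * n)\<close>.\<close>
  define B where "B = R * (1 + noise_const) / 2"
  define M where "M = m * sqrt (R * real n)"
  have c: "0 < noise_const" by (rule noise_const_pos)
  have m0: "0 < m" "m\<^sup>2 = 2 * (1 + noise_const)" using c by (auto simp: m)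
  have M0: "0 < M" "M\<^sup>2 = m\<^sup>2 * (R * real n)" using R n m0 by (auto simp: M_def power_mult_distrib)
  have origin: "1 - exp (- (sqrt R * u)\<^sup>2 / 2) * exp (- noise_exponent False \<delta> U u) \<le> B * u\<^sup>2" for u
  proof -
    have "1 - exp (- (sqrt R * u)\<^sup>2 / 2) * exp (- noise_exponent False \<delta> U u)
       \<le> R * u\<^sup>2 / 2 + noise_exponent False \<delta> U u"
    proof -
      define X where "X = - (sqrt R * u)\<^sup>2 / 2 + - noise_exponent False \<delta> U u"
      have "1 + X \<le> exp X" by (rule exp_ge_add_one_self)
      moreover have "X = - (R * u\<^sup>2 / 2) - noise_exponent False \<delta> U u"
        using R by (simp add: X_def power_mult_distrib)
      ultimately show ?thesis unfolding exp_add[symmetric] X_def[symmetric] by linarith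
    qed
    also have "noise_exponent False \<delta> U u \<le> noise_const * \<delta> * u\<^sup>2"
      using noise_exponent_le_square[of \<delta> U False u] R U by (simp add: noise_const_def)
    also have "noise_const * \<delta> * u\<^sup>2 \<le> noise_const * (R / 2) * u\<^sup>2"
      using R c by (intro mult_right_mono mult_left_mono) auto
    finally show ?thesis by (simp add: B_def field_simps)
  qed
  have agree: "exp (- (sqrt R * u)\<^sup>2 / 2) * exp (- noise_exponent False \<delta> U u)
     = exp (- (sqrt (R - \<delta>) * u)\<^sup>2 / 2) * exp (- noise_exponent True \<delta> U u)" if "\<bar>u\<bar> \<le> U" for u
    using noise_exponent_diff[OF U(1) that, of \<delta>] R
    by (simp add: exp_add[symmetric] power_mult_distrib field_simps)
  have nn: "0 \<le> noise_exponent b \<delta> U u" for b u using R by (intro noise_exponent_nonneg) auto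
  have "tv_close (gauss (sqrt R) \<star> \<nu> False) (gauss (sqrt (R - \<delta>)) \<star> \<nu> True)
     (ennreal (B / M\<^sup>2 + M * sqrt (2 / (R / 2)) * exp (- (R / 2) * U\<^sup>2 / 4)))"
    by (rule tv_close_gauss_convolution[OF _ _ _ _ _ nu(1) nu(1) nu(2) nu(2) _ _ _ _ agree origin M0(1) U(1)])
       (use R c nn in \<open>auto simp: B_def\<close>)
  moreover have "B / M\<^sup>2 + M * sqrt (2 / (R / 2)) * exp (- (R / 2) * U\<^sup>2 / 4) \<le> 1 / (2 * real n)"
  proof -
    have "B / M\<^sup>2 = 1 / (4 * real n)"
    proof -
      have "B = R * (1 + noise_const) * (1 / 2)" "M\<^sup>2 = R * (1 + noise_const) * (2 * real n)"
        unfolding B_def M0(2) m0(2) by simp_all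
      moreover have "R * (1 + noise_const) \<noteq> 0" using R c by simp
      ultimately show ?thesis using n by (simp only: mult_divide_mult_cancel_left) simp
    qed
    moreover have "M * sqrt (2 / (R / 2)) * exp (- (R / 2) * U\<^sup>2 / 4) \<le> 1 / (4 * real n)"
    proof -
      \<comment> \<open>The choice of \<open>U\<close> produces \<open>n\<close> to the power
        \<open>-(2 + q)\<close>: the 2 beats \<open>M\<close>, which grows like
        \<open>sqrt n\<close>, and leaves \<open>1 / n\<close>; the \<open>q\<close> absorbs the
        constant \<open>8 * m\<close>, since \<open>n\<close> is at least 2.\<close>
      have "- (R / 2) * U\<^sup>2 / 4 = - (real (2 + q) * ln (real n))" using U(2) by simp
      also have "exp \<dots> = 1 / real n ^ (2 + q)"
        using n by (simp only: exp_minus exp_of_nat_mult inverse_eq_divide) simp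
      finally have e: "exp (- (R / 2) * U\<^sup>2 / 4) = 1 / (real n * real n * real n ^ q)"
        by (simp add: power_add power2_eq_square)
      have "M * sqrt (2 / (R / 2)) = 2 * m * sqrt (real n)"
        using R by (simp add: M_def real_sqrt_mult real_sqrt_divide)
      also have "\<dots> \<le> 2 * m * real n"
        using m0 n by (intro mult_left_mono real_le_lsqrt) (auto simp: power2_eq_square)
      finally have s: "M * sqrt (2 / (R / 2)) \<le> 2 * m * real n" .
      have "8 * m \<le> real n ^ q"
        using q n power_mono[of 2 "real n" q] by simp
      then have "2 * m * real n * (1 / (real n * real n * real n ^ q)) \<le> 1 / (4 * real n)"
        using n by (simp add: field_simps)
      moreover have "M * sqrt (2 / (R / 2)) * exp (- (R / 2) * U\<^sup>2 / 4) \<le> 2 * m * real n * (1 / (real n * real n * real n ^ q))"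
        unfolding e by (intro mult_right_mono s) simp
      ultimately show ?thesis by linarith
    qed
    ultimately show ?thesis by simp
  qed
  ultimately show ?thesis by (elim tv_close_mono) (rule ennreal_leI)
qed

text \<open>Neighbouring vertices differ in one coordinate only, so \<open>n\<close> observations
  cost \<open>n\<close> times \<open>1 / (2 * n)\<close>, whatever the dimension.\<close>

lemma tv_close_hypercube:
  fixes k n p :: nat and Q :: "bool \<Rightarrow> real measure"
  assumes Q: "\<And>b. prob_space (Q b)" and tv: "tv_close (Q False) (Q True) (ennreal (1 / (2 * real n)))"
    and n: "1 \<le> n" and k: "k < p" "k \<notin> \<omega>"
  shows "tv_close (\<Pi>\<^sub>M j\<in>{..<n}. \<Pi>\<^sub>M i\<in>{..<p}. Q (i \<in> \<omega>))
    (\<Pi>\<^sub>M j\<in>{..<n}. \<Pi>\<^sub>M i\<in>{..<p}. Q (i \<in> insert k \<omega>)) (ennreal (1 / 2))"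
proof -
  let ?t = "ennreal (1 / (2 * real n))"
  have "tv_close (\<Pi>\<^sub>M i\<in>{..<p}. Q (i \<in> \<omega>)) (\<Pi>\<^sub>M i\<in>{..<p}. Q (i \<in> insert k \<omega>)) (\<Sum>i<p. if i = k then ?t else 0)"
    using tv k by (intro tv_close_PiM) (auto simp: Q tv_close_refl)
  also have "(\<Sum>i<p. if i = k then ?t else 0) = ?t" using k by simp
  finally have "tv_close (\<Pi>\<^sub>M j\<in>{..<n}. \<Pi>\<^sub>M i\<in>{..<p}. Q (i \<in> \<omega>))
      (\<Pi>\<^sub>M j\<in>{..<n}. \<Pi>\<^sub>M i\<in>{..<p}. Q (i \<in> insert k \<omega>)) (\<Sum>j<n. ?t)"
    by (intro tv_close_PiM prob_space_PiM Q) auto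
  moreover have "(\<Sum>j<n. ?t) = ennreal (1 / 2)"
    using n by (simp add: ennreal_of_nat_eq_real_of_nat ennreal_mult''[symmetric] field_simps)
  ultimately show ?thesis by simp
qed

text \<open>An estimator is turned into a test by thresholding its diagonal; each wrong decision
  costs \<open>(\<delta> / 2)\<^sup>2\<close> in the squared norm, and \<open>p / 8\<close> of them
  give \<open>p * \<delta>\<^sup>2 / 32\<close>.\<close>

lemma diagonal_lower_bound:
  fixes n p :: nat and R \<delta> \<beta> T S :: real
  assumes R: "0 < R" "0 < \<delta>" "\<delta> \<le> R / 2" and n: "1 \<le> n" and p: "1 \<le> p" "real p \<le> S"
    and nu: "\<And>b. real_distribution (\<nu> b)" "\<And>b u. char (\<nu> b) u = of_real (exp (- \<phi> b u))"
    and \<phi>: "\<And>b u. 0 \<le> \<phi> b u" "\<And>b u. \<phi> b u \<le> T * \<bar>u\<bar> powr \<beta>" and T: "0 < T"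
    and tv: "tv_close (gauss (sqrt R) \<star> \<nu> False) (gauss (sqrt (R - \<delta>)) \<star> \<nu> True) (ennreal (1 / (2 * real n)))"
    and est: "est \<in> estimators n p"
  shows "\<exists>(A, \<psi>, \<mu>) \<in> models p \<beta> S R T. 1 / 8 \<le> measure (obs_law n p A \<mu>)
    {y \<in> space (sample_borel n p). sqrt (real p / 32) * \<delta> \<le> frobenius_norm (est y - A)}"
proof -
  define d where "d b = (if b then R - \<delta> else R)" for b
  have d: "0 < d b" "d b \<le> R" for b using R by (auto simp: d_def)
  define Q where "Q b = (gauss (sqrt (d b)) \<star> \<nu> b)" for b
  have Q: "prob_space (Q b)" for b
    unfolding Q_def using d nu(1) real_distribution_convolution[OF real_distribution_gauss, of "sqrt (d b)" "\<nu> b"]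
    by (simp add: real_distribution_def)
  define A where "A \<omega> = diagonal p (\<lambda>k. d (k \<in> \<omega>))" for \<omega>
  define \<mu> where "\<mu> \<omega> = (\<Pi>\<^sub>M k\<in>{..<p}. \<nu> (k \<in> \<omega>))" for \<omega>
  define P where "P \<omega> = (\<Pi>\<^sub>M j\<in>{..<n}. \<Pi>\<^sub>M k\<in>{..<p}. Q (k \<in> \<omega>))" for \<omega>
  have obs: "obs_law n p (A \<omega>) (\<mu> \<omega>) = P \<omega>" for \<omega>
    unfolding A_def \<mu>_def P_def Q_def using d nu(1) by (intro obs_law_diagonal) auto
  have P: "prob_space (P \<omega>)" for \<omega> unfolding P_def by (intro prob_space_PiM Q)
  have setsP: "sets (P \<omega>) = sets (sample_borel n p)" for \<omega>
    unfolding P_def sample_borel_def vec_borel_def by (intro sets_PiM_cong refl) (simp add: Q_def)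
  have model: "(A \<omega>, char_vec p (\<mu> \<omega>), \<mu> \<omega>) \<in> models p \<beta> S R T" for \<omega>
  proof -
    have "A \<omega> \<in> cov_class p S R" unfolding A_def using d p by (intro diagonal_in_cov_class) auto
    moreover have law: "law_with_char p (char_vec p (\<mu> \<omega>)) (\<mu> \<omega>)"
    proof -
      have "prob_space (\<mu> \<omega>)" unfolding \<mu>_def using nu(1) by (intro prob_space_PiM) (auto simp: real_distribution_def)
      moreover have "sets (\<mu> \<omega>) = sets (vec_borel p)"
        unfolding \<mu>_def vec_borel_def using nu(1)
        by (intro sets_PiM_cong refl) (auto simp: real_distribution_def real_distribution_axioms_def)
      ultimately show ?thesis by (simp add: law_with_char_def)
    qed
    moreover have "char_vec p (\<mu> \<omega>) \<in> char_class p \<beta> T"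
    proof -
      have c: "char_vec p (\<mu> \<omega>) u = of_real (exp (- (\<Sum>k<p. \<phi> (k \<in> \<omega>) (u k))))" for u
        unfolding \<mu>_def by (subst char_vec_PiM) (auto simp: nu sum_negf[symmetric] exp_sum)
      have "\<bar>ln (cmod (char_vec p (\<mu> \<omega>) u))\<bar> \<le> T * (1 + (\<Sum>k<p. \<bar>u k\<bar> powr \<beta>))" for u
      proof -
        have "0 \<le> (\<Sum>k<p. \<phi> (k \<in> \<omega>) (u k))" using \<phi>(1) by (intro sum_nonneg) auto
        then have "\<bar>ln (cmod (char_vec p (\<mu> \<omega>) u))\<bar> = (\<Sum>k<p. \<phi> (k \<in> \<omega>) (u k))"
          unfolding c norm_of_real by simp
        also have "\<dots> \<le> (\<Sum>k<p. T * \<bar>u k\<bar> powr \<beta>)" using \<phi>(2) by (intro sum_mono) auto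
        also have "\<dots> \<le> T * (1 + (\<Sum>k<p. \<bar>u k\<bar> powr \<beta>))"
          using T by (simp add: sum_distrib_left[symmetric] algebra_simps)
        finally show ?thesis .
      qed
      moreover have "char_vec p (\<mu> \<omega>) u \<noteq> 0" for u unfolding c by simp
      ultimately show ?thesis using law by (auto simp: char_class_def)
    qed
    ultimately show ?thesis by (simp add: models_def)
  qed
  let ?S = "sample_borel n p"
  \<comment> \<open>The threshold is the midpoint of the two variances, so a wrong decision means an
    error of at least \<open>\<delta> / 2\<close> in that entry.\<close>
  define E where "E k = {y \<in> space ?S. R - \<delta> / 2 < est y $$ (k, k)}" for k
  have E: "E k \<in> sets ?S" if "k < p" for k
  proof -
    have "(\<lambda>y. est y $$ (k, k)) \<in> borel_measurable ?S" using est that by (auto simp: estimators_def)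
    then show ?thesis unfolding E_def by measurable
  qed
  have "\<exists>\<omega>\<subseteq>{..<p}. 1 / 8 \<le> measure (P \<omega>) {y \<in> space ?S. real p / 8 \<le> (\<Sum>k<p. of_bool ((k \<in> \<omega>) = (y \<in> E k)))}"
  proof (rule assouad[OF p(1) P setsP E])
    fix k \<omega> assume k: "k < p" "\<omega> \<subseteq> {..<p}" "k \<notin> \<omega>"
    interpret P0: prob_space "P \<omega>" by (rule P)
    interpret P1: prob_space "P (insert k \<omega>)" by (rule P)
    have Ek: "E k \<in> sets (P \<omega>)" "E k \<in> sets (P (insert k \<omega>))" using E[OF k(1)] setsP by auto
    have "tv_close (P \<omega>) (P (insert k \<omega>)) (ennreal (1 / 2))"
      unfolding P_def using tv n k by (intro tv_close_hypercube Q) (auto simp: Q_def d_def)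
    then have "(\<integral>\<^sup>+y. indicator (E k) y \<partial>P \<omega>) \<le> (\<integral>\<^sup>+y. indicator (E k) y \<partial>P (insert k \<omega>)) + ennreal (1 / 2)"
      using Ek by (intro tv_closeD[where h="indicator (E k)"] borel_measurable_indicator) (auto simp: indicator_def)
    then have "emeasure (P \<omega>) (E k) \<le> emeasure (P (insert k \<omega>)) (E k) + ennreal (1 / 2)"
      by (simp only: nn_integral_indicator[OF Ek(1)] nn_integral_indicator[OF Ek(2)])
    then have "measure (P \<omega>) (E k) \<le> measure (P (insert k \<omega>)) (E k) + 1 / 2"
      unfolding P0.emeasure_eq_measure P1.emeasure_eq_measure by (subst (asm) ennreal_plus[symmetric]) (auto simp del: ennreal_plus)
    moreover have "measure (P \<omega>) (space ?S - E k) = 1 - measure (P \<omega>) (E k)"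
      using P0.prob_compl[OF Ek(1)] sets_eq_imp_space_eq[OF setsP, of \<omega>] by simp
    ultimately show "1 / 2 \<le> measure (P \<omega>) (space ?S - E k) + measure (P (insert k \<omega>)) (E k)" by simp
  qed
  then obtain \<omega> where \<omega>: "1 / 8 \<le> measure (P \<omega>) {y \<in> space ?S. real p / 8 \<le> (\<Sum>k<p. of_bool ((k \<in> \<omega>) = (y \<in> E k)))}"
    by blast
  interpret P: prob_space "P \<omega>" by (rule P)
  have "measure (P \<omega>) {y \<in> space ?S. real p / 8 \<le> (\<Sum>k<p. of_bool ((k \<in> \<omega>) = (y \<in> E k)))}
     \<le> measure (P \<omega>) {y \<in> space ?S. sqrt (real p / 32) * \<delta> \<le> frobenius_norm (est y - A \<omega>)}"
  proof (rule P.finite_measure_mono)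
    show "{y \<in> space ?S. sqrt (real p / 32) * \<delta> \<le> frobenius_norm (est y - A \<omega>)} \<in> sets (P \<omega>)"
      unfolding setsP by (rule sets_estimator_error[OF est]) (simp add: A_def)
    show "{y \<in> space ?S. real p / 8 \<le> (\<Sum>k<p. of_bool ((k \<in> \<omega>) = (y \<in> E k)))}
      \<subseteq> {y \<in> space ?S. sqrt (real p / 32) * \<delta> \<le> frobenius_norm (est y - A \<omega>)}"
    proof safe
      fix y assume y: "y \<in> space ?S" and err: "real p / 8 \<le> (\<Sum>k<p. of_bool ((k \<in> \<omega>) = (y \<in> E k)))"
      have "real p / 32 * \<delta>\<^sup>2 = real p / 8 * (\<delta> / 2)\<^sup>2" by (simp add: power_divide)
      also have "\<dots> \<le> (\<Sum>k<p. of_bool ((k \<in> \<omega>) = (y \<in> E k))) * (\<delta> / 2)\<^sup>2"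
        using err by (intro mult_right_mono) auto
      also have "\<dots> = (\<Sum>k<p. of_bool ((k \<in> \<omega>) = (y \<in> E k)) * (\<delta> / 2)\<^sup>2)" by (rule sum_distrib_right)
      also have "\<dots> \<le> (\<Sum>k<p. (est y $$ (k, k) - A \<omega> $$ (k, k))\<^sup>2)"
      proof (rule sum_mono)
        fix k assume "k \<in> {..<p}"
        then have Akk: "A \<omega> $$ (k, k) = d (k \<in> \<omega>)" by (simp add: A_def diagonal_def)
        show "of_bool ((k \<in> \<omega>) = (y \<in> E k)) * (\<delta> / 2)\<^sup>2 \<le> (est y $$ (k, k) - A \<omega> $$ (k, k))\<^sup>2"
        proof (cases "(k \<in> \<omega>) = (y \<in> E k)")
          case True
          then have "\<bar>\<delta> / 2\<bar> \<le> \<bar>est y $$ (k, k) - d (k \<in> \<omega>)\<bar>"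
            using y R by (cases "k \<in> \<omega>") (auto simp: E_def d_def)
          then show ?thesis unfolding Akk using True by (simp add: abs_le_square_iff del: abs_divide)
        qed simp
      qed
      also have "\<dots> \<le> (\<Sum>i<p. \<Sum>j<p. (est y $$ (j, i) - A \<omega> $$ (j, i))\<^sup>2)"
        by (intro sum_mono member_le_sum) auto
      finally have "sqrt (real p / 32 * \<delta>\<^sup>2) \<le> frobenius_norm (est y - A \<omega>)"
        using estimator_error[OF est _ y, of "A \<omega>"] by (simp add: A_def)
      then show "sqrt (real p / 32) * \<delta> \<le> frobenius_norm (est y - A \<omega>)"
        unfolding real_sqrt_mult using R by simp
    qed
  qed
  then have "1 / 8 \<le> measure (obs_law n p (A \<omega>) (\<mu> \<omega>)) {y \<in> space ?S. sqrt (real p / 32) * \<delta> \<le> frobenius_norm (est y - A \<omega>)}"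
    unfolding obs using \<omega> by linarith
  then show ?thesis using model[of \<omega>] by (intro bexI[of _ "(A \<omega>, char_vec p (\<mu> \<omega>), \<mu> \<omega>)"]) auto
qed

section \<open>The minimax risk and the choice of the constants\<close>

lemma minimax_risk_ge:
  fixes f :: "'e \<Rightarrow> 'm \<Rightarrow> real"
  assumes "X \<noteq> {}" "\<And>x m. x \<in> X \<Longrightarrow> m \<in> Y \<Longrightarrow> f x m \<le> 1" "\<And>x. x \<in> X \<Longrightarrow> \<exists>m\<in>Y. c \<le> f x m"
  shows "c \<le> (INF x\<in>X. SUP m\<in>Y. f x m)"
proof (rule cINF_greatest[OF assms(1)])
  fix x assume x: "x \<in> X"
  then obtain m where m: "m \<in> Y" "c \<le> f x m" using assms(3) by blast
  have "bdd_above (f x ` Y)" using assms(2)[OF x] by (intro bdd_aboveI[of _ 1]) auto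
  then show "c \<le> (SUP m\<in>Y. f x m)" using m by (intro cSUP_upper2[of _ _ m])
qed

theorem theorem6:
  fixes \<beta> C1 C2 C3 cs :: real
  assumes "0 < \<beta>" "\<beta> < 2" "C1 > 0" "C2 > 0" "C3 > 0" "cs > 0"
  shows "\<exists>c1 > 0. \<exists>c2 > 0. \<forall>(n::nat) (p::nat) (S::real) (R::real) (T::real).
    n \<ge> 2 \<longrightarrow> p \<ge> 1 \<longrightarrow> S > 0 \<longrightarrow> R > 0 \<longrightarrow> T > 0 \<longrightarrow> S \<ge> real p \<longrightarrow>
    C1 * real p \<le> S \<longrightarrow> S \<le> C2 * real p \<longrightarrow>
    T * ln (real n) powr (- 1 + \<beta> / 2) \<le> C3 * R powr (\<beta> / 2) \<longrightarrow>
    T * ln (real n) powr cs \<ge> max 1 (R powr (\<beta> / 2)) \<longrightarrow>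
    (INF est \<in> estimators n p. SUP (A, \<psi>, \<nu>) \<in> models p \<beta> S R T.
       measure (obs_law n p A \<nu>)
         {y \<in> space (sample_borel n p). frobenius_norm (est y - A) \<ge> c1 * rate n \<beta> S R T}) > c2"
proof -
  define m where "m = sqrt (2 * (1 + noise_const))"
  \<comment> \<open>\<open>m\<close> depends on \<open>noise_const\<close> alone, so
    \<open>q\<close> and hence \<open>K\<close> are free of \<open>n\<close>, \<open>p\<close>,
    \<open>S\<close>, \<open>R\<close> and \<open>T\<close>.\<close>
  obtain q where q: "8 * m \<le> 2 ^ q" using real_arch_pow[of 2 "8 * m"] by (auto intro: less_imp_le)
  define K where "K = sqrt (8 * (2 + real q))"
  have K: "0 < K" "K\<^sup>2 = 8 * (2 + real q)" by (auto simp: K_def)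
  \<comment> \<open>The first bound keeps \<delta> below \<open>R / 2\<close> by the assumption with
    \<open>C3\<close>; the second keeps the noise in its class.\<close>
  define a where "a = min (1 / (2 * C3)) (1 / (noise_const * K powr (2 - \<beta>)))"
  have a: "0 < a" "a * C3 \<le> 1 / 2" "noise_const * (a * K powr (2 - \<beta>)) \<le> 1"
  proof -
    show "0 < a" using assms noise_const_pos K by (simp add: a_def)
    have "a * C3 \<le> 1 / (2 * C3) * C3" using assms by (intro mult_right_mono) (auto simp: a_def)
    then show "a * C3 \<le> 1 / 2" using assms by simp
    have pos: "0 < noise_const * K powr (2 - \<beta>)" using noise_const_pos K by simp
    have "a \<le> 1 / (noise_const * K powr (2 - \<beta>))" by (simp add: a_def)
    then have "a * (noise_const * K powr (2 - \<beta>)) \<le> 1" unfolding pos_le_divide_eq[OF pos] .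
    then show "noise_const * (a * K powr (2 - \<beta>)) \<le> 1" by (simp only: ac_simps)
  qed
  \<comment> \<open>Here 32 comes from the separation \<open>sqrt (p / 32) * \<delta>\<close>, and
    \<open>C2\<close> from replacing \<open>S\<close> by \<open>C2 * p\<close>.\<close>
  define c1 where "c1 = a / sqrt (32 * C2)"
  have "0 < c1" using a assms by (simp add: c1_def)
  have main: "1 / 8 \<le> (INF est \<in> estimators n p. SUP (A, \<psi>, \<nu>) \<in> models p \<beta> S R T.
       measure (obs_law n p A \<nu>)
         {y \<in> space (sample_borel n p). frobenius_norm (est y - A) \<ge> c1 * rate n \<beta> S R T})"
    if H: "n \<ge> 2" "p \<ge> 1" "S > 0" "R > 0" "T > 0" "S \<ge> real p" "S \<le> C2 * real p"
      "T * ln (real n) powr (- 1 + \<beta> / 2) \<le> C3 * R powr (\<beta> / 2)" for n p :: nat and S R T :: real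
  proof -
    define L where "L = ln (real n)"
    have L: "0 < L" using H by (simp add: L_def)
    \<comment> \<open>The rate without its factor \<open>S powr (1 / 2)\<close>, that is, the rate
      for a single entry.\<close>
    define \<rho> where "\<rho> = R powr (1 - \<beta> / 2) * T * L powr (- 1 + \<beta> / 2)"
    have \<rho>: "0 < \<rho>" using H L by (simp add: \<rho>_def)
    define \<delta> where "\<delta> = a * \<rho>"
    have \<delta>: "0 < \<delta>" using a \<rho> by (simp add: \<delta>_def)
    have "\<rho> = R powr (1 - \<beta> / 2) * (T * L powr (- 1 + \<beta> / 2))" by (simp add: \<rho>_def)
    also have "\<dots> \<le> R powr (1 - \<beta> / 2) * (C3 * R powr (\<beta> / 2))"
      using H by (intro mult_left_mono) (auto simp: L_def)
    also have "\<dots> = C3 * (R powr (1 - \<beta> / 2) * R powr (\<beta> / 2))" by simp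
    also have "R powr (1 - \<beta> / 2) * R powr (\<beta> / 2) = R" using H by (simp add: powr_add[symmetric])
    finally have "\<delta> \<le> a * (C3 * R)" unfolding \<delta>_def using a by (intro mult_left_mono) auto
    also have "\<dots> \<le> 1 / 2 * R" using mult_right_mono[OF a(2), of R] H by simp
    finally have \<delta>R: "\<delta> \<le> R / 2" by simp
    define U where "U = K * sqrt (L / R)"
    have U: "0 < U" "R * U\<^sup>2 = 8 * (2 + real q) * ln (real n)"
      using K L H by (auto simp: U_def power_mult_distrib L_def[symmetric])
    \<comment> \<open>The powers of \<open>L\<close> and \<open>R\<close> cancel; this fixes their
      exponents in the rate.\<close>
    have "\<delta> * U powr (2 - \<beta>) = a * T * K powr (2 - \<beta>)"
    proof -
      have "sqrt (L / R) powr (2 - \<beta>) = (L / R) powr (1 - \<beta> / 2)"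
        using L H by (simp add: powr_half_sqrt[symmetric] powr_powr diff_divide_distrib)
      also have "\<dots> = L powr (1 - \<beta> / 2) / R powr (1 - \<beta> / 2)" using L H by (simp add: powr_divide)
      finally have s: "U powr (2 - \<beta>) = K powr (2 - \<beta>) * (L powr (1 - \<beta> / 2) / R powr (1 - \<beta> / 2))"
        using K L H by (simp add: U_def powr_mult)
      have l: "L powr (- 1 + \<beta> / 2) * L powr (1 - \<beta> / 2) = 1" using L by (simp add: powr_add[symmetric])
      have "\<delta> * U powr (2 - \<beta>) = a * T * K powr (2 - \<beta>) * (L powr (- 1 + \<beta> / 2) * L powr (1 - \<beta> / 2))"
        unfolding s \<delta>_def \<rho>_def using H by simp
      then show ?thesis unfolding l by simp
    qed
    then have sU: "noise_const * (\<delta> * U powr (2 - \<beta>)) \<le> T"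
      using mult_right_mono[OF a(3), of T] H by (simp add: ac_simps)
    obtain \<nu> where \<nu>: "\<And>b. real_distribution (\<nu> b)"
      "\<And>b u. char (\<nu> b) u = of_real (exp (- noise_exponent b \<delta> U u))"
      using noise_law_exists[of \<delta> U] \<delta> U by (metis less_imp_le)
    have \<phi>: "noise_exponent b \<delta> U u \<le> T * \<bar>u\<bar> powr \<beta>" for b u
    proof -
      have "noise_exponent b \<delta> U u \<le> noise_const * (\<delta> * U powr (2 - \<beta>)) * \<bar>u\<bar> powr \<beta>"
        unfolding noise_const_def using assms \<delta> U by (intro noise_exponent_le_powr) auto
      also have "\<dots> \<le> T * \<bar>u\<bar> powr \<beta>" using sU by (intro mult_right_mono) auto
      finally show ?thesis .
    qed
    have rate: "c1 * rate n \<beta> S R T \<le> sqrt (real p / 32) * \<delta>"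
    proof -
      have "c1 * rate n \<beta> S R T = c1 * sqrt S * \<rho>"
        using H by (simp add: rate_def \<rho>_def L_def powr_half_sqrt)
      also have "\<dots> \<le> c1 * sqrt (C2 * real p) * \<rho>"
        using H \<open>0 < c1\<close> \<rho> by (intro mult_right_mono mult_left_mono) auto
      also have "\<dots> = sqrt (real p / 32) * \<delta>"
        using assms by (simp add: c1_def \<delta>_def real_sqrt_mult real_sqrt_divide)
      finally show ?thesis .
    qed
    show ?thesis
    proof (rule minimax_risk_ge)
      have "(\<lambda>_. 0\<^sub>m p p) \<in> estimators n p" by (simp add: estimators_def)
      then show "estimators n p \<noteq> {}" by blast
      fix est assume est: "est \<in> estimators n p"
      show "(case m of (A, \<psi>, \<nu>) \<Rightarrow> measure (obs_law n p A \<nu>)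
         {y \<in> space (sample_borel n p). frobenius_norm (est y - A) \<ge> c1 * rate n \<beta> S R T}) \<le> 1"
        if "m \<in> models p \<beta> S R T" for m
        using that prob_space.prob_le_1[OF prob_space_obs_law] by (auto split: prod.split)
      have "\<exists>(A, \<psi>, \<mu>) \<in> models p \<beta> S R T. 1 / 8 \<le> measure (obs_law n p A \<mu>)
          {y \<in> space (sample_borel n p). sqrt (real p / 32) * \<delta> \<le> frobenius_norm (est y - A)}"
      proof (rule diagonal_lower_bound[OF H(4) \<delta> \<delta>R _ H(2,6) \<nu> _ \<phi> H(5) _ est])
        show "tv_close (gauss (sqrt R) \<star> \<nu> False) (gauss (sqrt (R - \<delta>)) \<star> \<nu> True) (ennreal (1 / (2 * real n)))"
          by (rule tv_close_coordinate[OF H(4) \<delta> \<delta>R H(1) m_def q U \<nu>])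
      qed (use H \<delta> noise_exponent_nonneg in auto)
      then obtain A \<psi> \<mu> where M: "(A, \<psi>, \<mu>) \<in> models p \<beta> S R T" and le: "1 / 8 \<le> measure (obs_law n p A \<mu>)
          {y \<in> space (sample_borel n p). sqrt (real p / 32) * \<delta> \<le> frobenius_norm (est y - A)}" by auto
      interpret P: prob_space "obs_law n p A \<mu>" using M by (rule prob_space_obs_law)
      have "measure (obs_law n p A \<mu>) {y \<in> space (sample_borel n p). sqrt (real p / 32) * \<delta> \<le> frobenius_norm (est y - A)}
        \<le> measure (obs_law n p A \<mu>) {y \<in> space (sample_borel n p). frobenius_norm (est y - A) \<ge> c1 * rate n \<beta> S R T}"
      proof (rule P.finite_measure_mono)
        have "A \<in> carrier_mat p p" using M by (auto simp: models_def cov_class_def)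
        then show "{y \<in> space (sample_borel n p). frobenius_norm (est y - A) \<ge> c1 * rate n \<beta> S R T} \<in> sets (obs_law n p A \<mu>)"
          using sets_estimator_error[OF est] by (simp add: obs_law_def)
      qed (use rate in auto)
      with le M show "\<exists>m\<in>models p \<beta> S R T. 1 / 8 \<le> (case m of (A, \<psi>, \<nu>) \<Rightarrow> measure (obs_law n p A \<nu>)
         {y \<in> space (sample_borel n p). frobenius_norm (est y - A) \<ge> c1 * rate n \<beta> S R T})"
        by (intro bexI[of _ "(A, \<psi>, \<mu>)"]) auto
    qed
  qed
  show ?thesis
  \<comment> \<open>The bound 1/8 is not strict, so half of it is taken for the second
    constant.\<close>
  proof (rule exI[of _ c1], intro conjI \<open>0 < c1\<close>, rule exI[of _ "1 / 16"], intro conjI allI impI)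
    fix n p :: nat and S R T :: real
    assume "n \<ge> 2" "p \<ge> 1" "S > 0" "R > 0" "T > 0" "S \<ge> real p" "S \<le> C2 * real p"
      "T * ln (real n) powr (- 1 + \<beta> / 2) \<le> C3 * R powr (\<beta> / 2)"
    from less_le_trans[OF _ main[OF this], of "1 / 16"]
    show "(INF est \<in> estimators n p. SUP (A, \<psi>, \<nu>) \<in> models p \<beta> S R T.
       measure (obs_law n p A \<nu>)
         {y \<in> space (sample_borel n p). frobenius_norm (est y - A) \<ge> c1 * rate n \<beta> S R T}) > 1 / 16"
      by simp
  qed simp
qed

end
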